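(* Let $n\in\mathbb{N}$, $0<\alpha<n$, and $1<p<\infty$. The $A_\infty^{\rm loc}$ weight $\omega$ on $\mathbb{R}^n$ defined by $\omega(x)=e^{-3p|x|}$ satisfies $$B_{\alpha,p}^{\omega}(\mathbb{R}^n)=0 .$$
   Context: $|x|$ is the Euclidean norm. The Bessel kernel is $G_\alpha=\mathcal{F}^{-1}\left[(1+4\pi^2|\cdot|^2)^{-\alpha/2}\right]$, where $\mathcal{F}^{-1}$ is the inverse (distributional) Fourier transform on $\mathbb{R}^n$. For a weight $\omega$ (locally integrable, positive a.e.), the weighted Bessel capacity of $E\subseteq\mathbb{R}^n$ is $B_{\alpha,p}^{\omega}(E)=\inf\left\{\int_{\mathbb{R}^n}f^p\omega\,dx:\ f\ge0\text{ measurable},\ f\in L^p(\omega),\ (G_\alpha\ast f)(x)\ge1\text{ for all }x\in E\right\}$. $A_\infty^{\rm loc}$ is the class of weights with $\sup_{\ell(Q)\le1}\left(\frac{1}{|Q|}\int_Q\omega\right)\exp\left(\frac{1}{|Q|}\int_Q\log\omega^{-1}\right)<\infty$, the supremum over cubes $Q$ with sides parallel to the axes and side length $\ell(Q)\le1$. *)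

theory Defs
  imports "HOL-Analysis.Analysis"
begin

section \<open>Schwartz functions, tempered distributions and the Fourier transform\<close>

definition partial_deriv :: "'n \<Rightarrow> (real ^ 'n \<Rightarrow> complex) \<Rightarrow> real ^ 'n \<Rightarrow> complex" where
  "partial_deriv i \<phi> x = vector_derivative (\<lambda>t. \<phi> (x + t *\<^sub>R axis i 1)) (at 0)"

text \<open>Multi-indices are encoded as lists of coordinate directions. Since all iterated partial
  derivatives are required to be differentiable everywhere, the functions are \<open>C\<^sup>\<infinity>\<close>.\<close>

definition schwartz :: "(real ^ 'n \<Rightarrow> complex) set" where
  "schwartz = {\<phi>. \<forall>is.
     (\<forall>x. foldr partial_deriv is \<phi> differentiable (at x)) \<and>
     (\<forall>k::nat. bounded (range (\<lambda>x. norm x ^ k *\<^sub>R foldr partial_deriv is \<phi> x)))}"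

definition inv_fourier :: "(real ^ 'n \<Rightarrow> complex) \<Rightarrow> real ^ 'n \<Rightarrow> complex" where
  "inv_fourier \<phi> x = (LINT \<xi>|lebesgue. cis (2 * pi * (x \<bullet> \<xi>)) * \<phi> \<xi>)"

text \<open>Tempered distributions are represented by their values on Schwartz functions; values
  of these functionals outside \<^const>\<open>schwartz\<close> are irrelevant.\<close>

type_synonym 'n distribution = "(real ^ 'n \<Rightarrow> complex) \<Rightarrow> complex"

definition regular_distr :: "(real ^ 'n::finite \<Rightarrow> real) \<Rightarrow> 'n distribution" where
  "regular_distr g \<phi> = (LINT x|lebesgue. of_real (g x) * \<phi> x)"

definition inv_fourier_distr :: "'n::finite distribution \<Rightarrow> 'n distribution" where
  "inv_fourier_distr T \<phi> = T (inv_fourier \<phi>)"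

definition locally_integrable :: "(real ^ 'n \<Rightarrow> real) \<Rightarrow> bool" where
  "locally_integrable g \<longleftrightarrow> (\<forall>K. compact K \<longrightarrow> set_integrable lebesgue K g)"

definition distr_is_function :: "'n::finite distribution \<Rightarrow> (real ^ 'n \<Rightarrow> real) \<Rightarrow> bool" where
  "distr_is_function T g \<longleftrightarrow> locally_integrable g \<and>
     (\<forall>\<phi>\<in>schwartz. integrable lebesgue (\<lambda>x. of_real (g x) * \<phi> x) \<and> T \<phi> = regular_distr g \<phi>)"

section \<open>Bessel kernel and weighted Bessel capacity\<close>

text \<open>A function representing a distribution is unique only up to null sets. The kernel is used
  below only through integrals, so the choice of the representative does not matter.\<close>

definition bessel_kernel :: "real \<Rightarrow> real ^ 'n \<Rightarrow> real" where
  "bessel_kernel \<alpha> = (SOME G. distr_is_function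
     (inv_fourier_distr (regular_distr (\<lambda>\<xi>. (1 + 4 * pi\<^sup>2 * (norm \<xi>)\<^sup>2) powr (- \<alpha> / 2)))) G)"

text \<open>The convolution of the Bessel kernel with a nonnegative function, with values in
  \<open>[0, \<infinity>]\<close>. For \<open>\<alpha> > 0\<close> the kernel is positive almost everywhere, so that \<^const>\<open>ennreal\<close>
  truncates at most on a null set.\<close>

definition bessel_potential :: "real \<Rightarrow> (real ^ 'n \<Rightarrow> real) \<Rightarrow> real ^ 'n \<Rightarrow> ennreal" where
  "bessel_potential \<alpha> f x = (\<integral>\<^sup>+ y. ennreal (bessel_kernel \<alpha> (x - y) * f y) \<partial>lebesgue)"

definition bessel_capacity ::
    "real \<Rightarrow> real \<Rightarrow> (real ^ 'n \<Rightarrow> real) \<Rightarrow> (real ^ 'n) set \<Rightarrow> ennreal" where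
  "bessel_capacity \<alpha> p \<omega> E =
     Inf {(\<integral>\<^sup>+ x. ennreal (f x powr p * \<omega> x) \<partial>lebesgue) | f.
            f \<in> borel_measurable lebesgue \<and> (\<forall>x. 0 \<le> f x) \<and>
            (\<integral>\<^sup>+ x. ennreal (f x powr p * \<omega> x) \<partial>lebesgue) < \<infinity> \<and>
            (\<forall>x\<in>E. 1 \<le> bessel_potential \<alpha> f x)}"

section \<open>Local \<open>A\<^sub>\<infinity>\<close> weights\<close>

definition weight :: "(real ^ 'n \<Rightarrow> real) \<Rightarrow> bool" where
  "weight \<omega> \<longleftrightarrow> locally_integrable \<omega> \<and> (AE x in lebesgue. 0 < \<omega> x)"

definition cube :: "real ^ 'n \<Rightarrow> real \<Rightarrow> (real ^ 'n) set" where
  "cube a l = cbox a (\<chi> i. a $ i + l)"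

definition average :: "(real ^ 'n) set \<Rightarrow> (real ^ 'n \<Rightarrow> real) \<Rightarrow> real" where
  "average Q g = (LINT x:Q|lebesgue. g x) / measure lebesgue Q"

text \<open>For a weight \<open>\<omega>\<close>, the positive part of \<open>ln \<omega>\<close> is locally integrable, so the integral of
  \<open>ln (1 / \<omega>)\<close> over a cube exists in \<open>(-\<infinity>, \<infinity>]\<close>. If it is \<open>\<infinity>\<close>, then the supremum is infinite;
  as the Bochner integral would be 0 in that case, it is excluded by an integrability condition.\<close>

definition A_infty_loc :: "(real ^ 'n \<Rightarrow> real) set" where
  "A_infty_loc = {\<omega>. weight \<omega> \<and>
     (\<forall>a l. 0 < l \<and> l \<le> 1 \<longrightarrow> set_integrable lebesgue (cube a l) (\<lambda>x. ln (1 / \<omega> x))) \<and>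
     bdd_above {average (cube a l) \<omega> * exp (average (cube a l) (\<lambda>x. ln (1 / \<omega> x))) | a l.
       0 < l \<and> l \<le> 1}}"

end

theory Submission
  imports Defs "HOL-Probability.Probability" "HOL-Real_Asymp.Real_Asymp"
begin

text \<open>Writing \<open>(1 + 4 \<pi>\<^sup>2 |\<xi>|\<^sup>2) powr - \<beta>\<close> with \<open>\<beta> = \<alpha> / 2\<close> as an integral of Gaussians
  \<open>exp (- 4 \<pi>\<^sup>2 t |\<xi>|\<^sup>2)\<close> against the Gamma density in \<open>t\<close>, Fubini's theorem identifies the Bessel
  kernel with the corresponding average of heat kernels, and the contribution of \<open>t \<approx> |x|\<close> shows
  that it decays no faster than \<open>exp (- 5/4 |x|)\<close>, up to powers of \<open>|x|\<close>. Hence the potential of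
  \<open>f = \<epsilon> exp (2 |\<cdot>|)\<close> is infinite everywhere for each \<open>\<epsilon> > 0\<close>, whereas the integral of
  \<open>f\<^sup>p \<omega> = \<epsilon>\<^sup>p exp (- p |\<cdot>|)\<close> is a constant multiple of \<open>\<epsilon>\<^sup>p\<close>.

  The representative of the kernel is arbitrary. It is only tested against
  the Schwartz functions \<open>exp (- |x - a|\<^sup>2)\<close> with \<open>|a| \<rightarrow> \<infinity>\<close>: suitable multiples of them lie below
  \<open>f\<close>, so their pairings with the kernel, which do not depend on the representative, bound the
  potential from below.\<close>

section \<open>Integration over Euclidean spaces\<close>

lemma borel_measurable_cis [measurable]: "cis \<in> borel_measurable borel"
  by (intro borel_measurable_continuous_onI continuous_on_cis continuous_on_id)

lemma lborel_integral_translate: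
  fixes f :: "'a::euclidean_space \<Rightarrow> 'b::{banach, second_countable_topology}"
  assumes [measurable]: "f \<in> borel_measurable borel"
  shows "(LINT x|lborel. f (c + x)) = (LINT x|lborel. f x)"
proof -
  have "(LINT x|lborel. f x) = (LINT x|distr lborel borel ((+) c). f x)"
    by (simp add: lborel_distr_plus)
  also have "\<dots> = (LINT x|lborel. f (c + x))"
    by (subst integral_distr) auto
  finally show ?thesis by simp
qed

lemma lborel_integrable_translate:
  fixes f :: "'a::euclidean_space \<Rightarrow> 'b::{banach, second_countable_topology}"
  assumes "integrable lborel f"
  shows "integrable lborel (\<lambda>x. f (c + x))"
proof -
  have [measurable]: "f \<in> borel_measurable borel"
    using assms by auto
  have "integrable (distr lborel borel ((+) c)) f"
    using assms by (simp add: lborel_distr_plus)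
  then show ?thesis
    by (subst (asm) integrable_distr_eq) auto
qed

text \<open>The substitution is an affine map with all diagonal coefficients -1, so its Jacobian
  factor is 1. It is formulated for Lebesgue measurable integrands because the chosen representative
  of the Bessel kernel need not be Borel.\<close>

lemma nn_integral_lebesgue_reflect:
  fixes g :: "'a::euclidean_space \<Rightarrow> ennreal"
  assumes [measurable]: "g \<in> borel_measurable lebesgue"
  shows "(\<integral>\<^sup>+ y. g (x - y) \<partial>lebesgue) = (\<integral>\<^sup>+ z. g z \<partial>lebesgue)"
proof -
  define T where "T = (\<lambda>y. x + (\<Sum>j\<in>Basis. ((-1) * (y \<bullet> j)) *\<^sub>R (j::'a)))"
  have T: "T = (\<lambda>y. x - y)"
    by (auto simp: T_def fun_eq_iff sum_negf euclidean_representation)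
  have eq: "lebesgue = density (distr lebesgue lebesgue T) (\<lambda>_. (\<Prod>j\<in>Basis. \<bar>-1 :: real\<bar>))"
    using lebesgue_affine_euclidean[of "\<lambda>_. -1" x] by (simp add: T_def)
  have [measurable]: "T \<in> lebesgue \<rightarrow>\<^sub>M lebesgue"
    using lebesgue_affine_measurable[of "\<lambda>_. -1" x] by (simp add: T_def)
  have "(\<integral>\<^sup>+ z. g z \<partial>lebesgue) = (\<integral>\<^sup>+ z. g z \<partial>distr lebesgue lebesgue T)"
    by (subst eq) (simp add: density_1)
  also have "\<dots> = (\<integral>\<^sup>+ y. g (T y) \<partial>lebesgue)"
    by (rule nn_integral_distr) auto
  finally show ?thesis by (simp add: T)
qed

text \<open>By \<open>lborel_eq\<close>, \<open>lborel\<close> is the image of the product of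
  one-dimensional measures under the coordinate map, so both claims reduce to Fubini for functions
  of separate variables.\<close>

lemma
  fixes f :: "'a::euclidean_space \<Rightarrow> real \<Rightarrow> 'b::{real_normed_field,banach,second_countable_topology}"
  assumes f: "\<And>b. b \<in> Basis \<Longrightarrow> integrable lborel (f b)"
  shows integrable_lborel_prod: "integrable lborel (\<lambda>x. \<Prod>b\<in>Basis. f b (x \<bullet> b))"
    and integral_lborel_prod:
      "(LINT x|lborel. (\<Prod>b\<in>Basis. f b (x \<bullet> b))) = (\<Prod>b\<in>Basis. LINT u|lborel. f b u)"
proof -
  interpret product_sigma_finite "\<lambda>_::'a. lborel :: real measure" ..
  have [measurable]: "f b \<in> borel_measurable borel" if "b \<in> Basis" for b
    using f[OF that] by auto
  have coord: "(\<Sum>c\<in>Basis. y c *\<^sub>R c) \<bullet> b = y b" if "b \<in> Basis" for y and b :: 'a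
    using that by (simp add: inner_sum_left inner_Basis if_distrib cong: if_cong)
  have "(\<lambda>x. \<Prod>b\<in>Basis. f b (x \<bullet> b)) \<in> borel_measurable borel"
    by measurable
  then show "integrable lborel (\<lambda>x. \<Prod>b\<in>Basis. f b (x \<bullet> b))"
    and "(LINT x|lborel. (\<Prod>b\<in>Basis. f b (x \<bullet> b))) = (\<Prod>b\<in>Basis. LINT u|lborel. f b u)"
    using product_integrable_prod[of Basis f] product_integral_prod[of Basis f] f
    by (simp_all add: lborel_eq[where 'a='a] integrable_distr_eq integral_distr coord cong: prod.cong)
qed

section \<open>Gaussian integrals and their Fourier transforms\<close>

lemma
  fixes s v :: real
  assumes s: "0 < s"
  shows integrable_gaussian_fourier_real:
      "integrable lborel (\<lambda>u. exp (\<i> * (v * u) - s * u\<^sup>2))"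
    and integral_gaussian_fourier_real:
      "(LINT u|lborel. exp (\<i> * (v * u) - s * u\<^sup>2)) = sqrt (pi / s) * exp (- v\<^sup>2 / (4 * s))"
proof -
  \<comment> \<open>With this scaling the standard normal density at \<open>c * u\<close> is a
    multiple of exp (- s u^2), so the integral becomes the characteristic function of the standard
    normal distribution at \<open>v / c\<close>.\<close>
  define c where "c = sqrt (2 * s)"
  have c: "c > 0" "c\<^sup>2 = 2 * s" using s by (auto simp: c_def)
  let ?F = "\<lambda>y. std_normal_density y *\<^sub>R iexp (v / c * y)"
  have F: "?F (0 + c * u) = (1 / sqrt (2 * pi)) *\<^sub>R exp (\<i> * (v * u) - s * u\<^sup>2)" for u
    using c by (simp add: std_normal_density_def power_mult_distrib exp_diff exp_minus
        scaleR_conv_of_real field_simps flip: exp_of_real)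
  have intF: "integrable lborel ?F"
    by (rule Bochner_Integration.integrable_bound[OF integrable_normal_density[of 1 0]]) auto
  have "complex_of_real (exp (- ((v / c)\<^sup>2) / 2)) = (CLINT y|std_normal_distribution. iexp (v / c * y))"
    using fun_cong[OF char_std_normal_distribution, of "v / c"] by (simp add: char_def)
  also have "\<dots> = (LINT y|lborel. ?F y)"
    by (subst integral_density) auto
  also have "\<dots> = c *\<^sub>R (LINT u|lborel. ?F (0 + c * u))"
    using c by (subst lborel_integral_real_affine[where c = c and t = 0]) auto
  also have "\<dots> = (c / sqrt (2 * pi)) *\<^sub>R (LINT u|lborel. exp (\<i> * (v * u) - s * u\<^sup>2))"
    unfolding F by simp
  finally have "(LINT u|lborel. exp (\<i> * (v * u) - s * u\<^sup>2))
      = (sqrt (2 * pi) / c) *\<^sub>R complex_of_real (exp (- ((v / c)\<^sup>2) / 2))"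
    using c by (simp add: field_simps scaleR_conv_of_real)
  moreover have "sqrt (2 * pi) / c = sqrt (pi / s)"
    by (simp add: c_def real_sqrt_divide real_sqrt_mult)
  moreover have "(v / c)\<^sup>2 / 2 = v\<^sup>2 / (4 * s)"
    using c by (simp add: power_divide)
  ultimately show "(LINT u|lborel. exp (\<i> * (v * u) - s * u\<^sup>2)) = sqrt (pi / s) * exp (- v\<^sup>2 / (4 * s))"
    by (simp add: scaleR_conv_of_real)
  have "integrable lborel (\<lambda>u. ?F (0 + c * u))"
    using c intF by (intro lborel_integrable_real_affine) auto
  then have "integrable lborel (\<lambda>u. sqrt (2 * pi) *\<^sub>R ?F (0 + c * u))"
    by (rule integrable_scaleR_right)
  then show "integrable lborel (\<lambda>u. exp (\<i> * (v * u) - s * u\<^sup>2))"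
    unfolding F scaleR_scaleR by simp
qed

text \<open>Phase and Gaussian both factor over the coordinates, which reduces everything to
  dimension one. The frequency scale \<open>v\<close> stays free: 2 pi matches
  \<open>inv_fourier\<close>, and 0 gives the plain Gaussian integral.\<close>

lemma
  fixes x :: "'a::euclidean_space" and s v :: real
  assumes s: "0 < s"
  shows integrable_gaussian_fourier:
      "integrable lborel (\<lambda>\<xi>. cis (v * (x \<bullet> \<xi>)) * exp (- s * (norm \<xi>)\<^sup>2))"
    and integral_gaussian_fourier:
      "(LINT \<xi>|lborel. cis (v * (x \<bullet> \<xi>)) * exp (- s * (norm \<xi>)\<^sup>2))
        = (pi / s) powr (DIM('a) / 2) * exp (- v\<^sup>2 * (norm x)\<^sup>2 / (4 * s))"
proof -
  let ?f = "\<lambda>b u. exp (\<i> * ((v * (x \<bullet> b)) * u) - s * u\<^sup>2)"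
  have split: "cis (v * (x \<bullet> \<xi>)) * exp (- s * (norm \<xi>)\<^sup>2) = (\<Prod>b\<in>Basis. ?f b (\<xi> \<bullet> b))" for \<xi> :: 'a
  proof -
    have "(\<Prod>b\<in>Basis. ?f b (\<xi> \<bullet> b))
        = exp (\<Sum>b\<in>Basis. \<i> * (v * (x \<bullet> b) * (\<xi> \<bullet> b)) - s * (\<xi> \<bullet> b)\<^sup>2)"
      by (simp add: exp_sum)
    also have "(\<Sum>b\<in>Basis. \<i> * (v * (x \<bullet> b) * (\<xi> \<bullet> b)) - s * (\<xi> \<bullet> b)\<^sup>2)
        = \<i> * complex_of_real (v * (x \<bullet> \<xi>)) - complex_of_real (s * (\<xi> \<bullet> \<xi>))"
      by (subst (3 4) euclidean_inner)
        (simp add: sum_subtractf sum_distrib_left power2_eq_square mult_ac)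
    finally show ?thesis
      by (simp add: cis_conv_exp exp_diff exp_minus power2_norm_eq_inner field_simps flip: exp_of_real)
  qed
  show "integrable lborel (\<lambda>\<xi>. cis (v * (x \<bullet> \<xi>)) * exp (- s * (norm \<xi>)\<^sup>2))"
    unfolding split by (rule integrable_lborel_prod) (rule integrable_gaussian_fourier_real[OF s])
  have "(LINT \<xi>|lborel. cis (v * (x \<bullet> \<xi>)) * exp (- s * (norm \<xi>)\<^sup>2))
      = (\<Prod>b\<in>Basis. complex_of_real (sqrt (pi / s) * exp (- (v * (x \<bullet> b))\<^sup>2 / (4 * s))))"
    unfolding split
    by (subst integral_lborel_prod[OF integrable_gaussian_fourier_real[OF s]])
      (simp only: integral_gaussian_fourier_real[OF s])
  also have "\<dots> = complex_of_real (sqrt (pi / s) ^ DIM('a) * exp (\<Sum>b\<in>Basis. - (v * (x \<bullet> b))\<^sup>2 / (4 * s)))"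
    by (simp add: prod.distrib exp_sum)
  also have "(\<Sum>b\<in>Basis. - (v * (x \<bullet> b))\<^sup>2 / (4 * s)) = - v\<^sup>2 * (norm x)\<^sup>2 / (4 * s)"
    unfolding power2_norm_eq_inner euclidean_inner[of x x]
    by (simp add: sum_divide_distrib sum_distrib_left sum_negf power2_eq_square mult_ac)
  also have "sqrt (pi / s) ^ DIM('a) = (pi / s) powr (DIM('a) / 2)"
    using s by (simp add: powr_half_sqrt[symmetric] powr_realpow[symmetric] powr_powr)
  finally show "(LINT \<xi>|lborel. cis (v * (x \<bullet> \<xi>)) * exp (- s * (norm \<xi>)\<^sup>2))
        = (pi / s) powr (DIM('a) / 2) * exp (- v\<^sup>2 * (norm x)\<^sup>2 / (4 * s))"
    by simp
qed

lemma
  fixes s :: real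
  assumes s: "0 < s"
  shows integrable_gaussian: "integrable lborel (\<lambda>x::'a::euclidean_space. exp (- s * (norm x)\<^sup>2))"
    and integral_gaussian:
      "(LINT x::'a|lborel. exp (- s * (norm x)\<^sup>2)) = (pi / s) powr (DIM('a) / 2)"
proof -
  have *: "cis (0 * (0 \<bullet> x)) * complex_of_real (exp (- s * (norm x)\<^sup>2)) = complex_of_real (exp (- s * (norm x)\<^sup>2))"
    for x :: 'a by simp
  show "integrable lborel (\<lambda>x::'a. exp (- s * (norm x)\<^sup>2))"
    using integrable_gaussian_fourier[OF s, of 0 "0::'a"] unfolding * complex_of_real_integrable_eq .
  show "(LINT x::'a|lborel. exp (- s * (norm x)\<^sup>2)) = (pi / s) powr (DIM('a) / 2)"
    using integral_gaussian_fourier[OF s, of 0 "0::'a"] unfolding * integral_complex_of_real of_real_eq_iff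
    by simp
qed

section \<open>An integrable majorant with polynomial decay\<close>

definition decay :: "real ^ 'n::finite \<Rightarrow> real" where
  "decay x = 1 / (1 + (norm x)\<^sup>2) ^ CARD('n)"

lemma decay_pos: "0 < decay x"
  by (simp add: decay_def add_pos_nonneg)

lemma decay_measurable [measurable]: "decay \<in> borel_measurable borel"
  unfolding decay_def[abs_def] by measurable

lemma integrable_inverse_one_plus_square: "integrable lborel (\<lambda>u::real. 1 / (1 + u\<^sup>2))"
  using integrable_inverse_1_plus_square by (simp add: set_integrable_def inverse_eq_divide)

text \<open>The exponent \<open>CARD('n)\<close> provides one factor per coordinate. Each factor 1 +
  |x|^2 is at least 1 + (x . b)^2, so \<open>decay\<close> lies below a product of one-dimensional
  Cauchy profiles.\<close>

lemma integrable_decay: "integrable lborel (decay :: real ^ 'n \<Rightarrow> real)"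
proof (rule Bochner_Integration.integrable_bound)
  show "integrable lborel (\<lambda>x::real^'n. \<Prod>b\<in>Basis. 1 / (1 + (x \<bullet> b)\<^sup>2))"
    by (rule integrable_lborel_prod) (rule integrable_inverse_one_plus_square)
  have "(\<Prod>b\<in>Basis. 1 + (x \<bullet> b)\<^sup>2) \<le> (\<Prod>b\<in>(Basis :: (real^'n) set). 1 + (norm x)\<^sup>2)" for x :: "real^'n"
    using Basis_le_norm[of _ x] by (intro prod_mono) (auto intro!: add_nonneg_nonneg simp flip: abs_le_square_iff)
  moreover have "0 < (\<Prod>b\<in>(Basis :: (real^'n) set). 1 + (x \<bullet> b)\<^sup>2)" for x
    by (intro prod_pos) (auto intro!: add_pos_nonneg)
  ultimately have "decay x \<le> (\<Prod>b\<in>Basis. 1 / (1 + (x \<bullet> b)\<^sup>2))" for x :: "real^'n"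
    by (simp add: decay_def prod_dividef) (intro divide_left_mono, auto intro!: mult_pos_pos simp: add_pos_nonneg)
  then show "AE x in lborel. norm (decay x) \<le> norm (\<Prod>b\<in>Basis. 1 / (1 + ((x::real^'n) \<bullet> b)\<^sup>2))"
    by (intro AE_I2) (simp only: real_norm_def abs_of_pos[OF decay_pos] order.trans[OF _ abs_ge_self])
qed simp

section \<open>Inverse Fourier transforms of Schwartz functions\<close>

text \<open>Two moment bounds, of order 0 and \<open>2 * CARD('n)\<close>, already yield an
  integrable majorant. For |x| \<le> 1 the first one does the work, for |x| > 1 the second.\<close>

lemma norm_le_decay:
  fixes x :: "real ^ 'n"
  assumes "norm y \<le> A" and "norm x ^ (2 * CARD('n)) * norm y \<le> B"
  shows "norm y \<le> 2 ^ CARD('n) * (A + B) * decay x"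
proof -
  let ?n = "CARD('n)" and ?r = "norm x"
  have "(1 + ?r\<^sup>2) ^ ?n \<le> 2 ^ ?n * (1 + ?r ^ (2 * ?n))"
  proof (cases "?r \<le> 1")
    case True
    then have "(1 + ?r\<^sup>2) ^ ?n \<le> 2 ^ ?n"
      by (intro power_mono) (auto simp: power_le_one)
    also have "\<dots> \<le> 2 ^ ?n * (1 + ?r ^ (2 * ?n))"
      by simp
    finally show ?thesis .
  next
    case False
    then have "1 \<le> ?r\<^sup>2" by simp
    then have "(1 + ?r\<^sup>2) ^ ?n \<le> (2 * ?r\<^sup>2) ^ ?n"
      by (intro power_mono) auto
    also have "\<dots> \<le> 2 ^ ?n * (1 + ?r ^ (2 * ?n))"
      by (simp add: power_mult_distrib power_mult)
    finally show ?thesis .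
  qed
  then have "(1 + ?r\<^sup>2) ^ ?n * norm y \<le> (2 ^ ?n * (1 + ?r ^ (2 * ?n))) * norm y"
    by (rule mult_right_mono) simp
  also have "\<dots> = 2 ^ ?n * (norm y + ?r ^ (2 * ?n) * norm y)"
    by (simp add: algebra_simps)
  also have "\<dots> \<le> 2 ^ ?n * (A + B)"
    using assms by simp
  finally have "norm y \<le> 2 ^ ?n * (A + B) / (1 + ?r\<^sup>2) ^ ?n"
    by (simp add: pos_le_divide_eq add_pos_nonneg mult.commute)
  then show ?thesis
    by (simp add: decay_def)
qed

text \<open>Serves to dominate difference quotients, where the derivative is evaluated at a point up
  to distance 1 away from x.\<close>

lemma decay_le_decay_shift:
  fixes x :: "real ^ 'n"
  assumes "norm u \<le> 1"
  shows "decay (x + u) \<le> 3 ^ CARD('n) * decay x"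
proof -
  let ?r = "norm (x + u)"
  have "norm x \<le> ?r + 1"
    using norm_triangle_ineq4[of "x + u" u] assms by simp
  then have "(norm x)\<^sup>2 \<le> (?r + 1)\<^sup>2"
    by (intro power_mono) auto
  also have "\<dots> \<le> 2 + 2 * ?r\<^sup>2"
    using zero_le_power2[of "?r - 1"] by (simp add: power2_eq_square algebra_simps)
  finally have "1 + (norm x)\<^sup>2 \<le> 3 * (1 + ?r\<^sup>2)"
    by (smt (verit) zero_le_power2)
  then have "(1 + (norm x)\<^sup>2) ^ CARD('n) \<le> (3 * (1 + ?r\<^sup>2)) ^ CARD('n)"
    by (intro power_mono) auto
  then show ?thesis
    unfolding decay_def power_mult_distrib
    by (simp add: divide_simps add_pos_nonneg mult.commute)
qed

lemma schwartz_partial_deriv: "\<phi> \<in> schwartz \<Longrightarrow> partial_deriv i \<phi> \<in> schwartz"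
proof -
  assume "\<phi> \<in> schwartz"
  \<comment> \<open>\<open>foldr\<close> applies the last entry of the list first, so the extra
    derivative is appended at the end.\<close>
  moreover have "foldr partial_deriv is (partial_deriv i \<phi>) = foldr partial_deriv (is @ [i]) \<phi>" for "is"
    by simp
  ultimately show ?thesis
    unfolding schwartz_def mem_Collect_eq by metis
qed

lemma schwartz_differentiable: "\<phi> \<in> schwartz \<Longrightarrow> \<phi> differentiable (at x)"
  unfolding schwartz_def by (auto dest!: spec[of _ "[]"])

lemma schwartz_measurable: "\<phi> \<in> schwartz \<Longrightarrow> \<phi> \<in> borel_measurable borel"
  by (intro borel_measurable_continuous_onI continuous_at_imp_continuous_on ballI
      differentiable_imp_continuous_within schwartz_differentiable)

lemma schwartz_bounded:
  assumes "\<phi> \<in> schwartz"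
  obtains B where "\<And>x. norm (\<phi> x) \<le> B"
proof -
  have "\<forall>k. bounded (range (\<lambda>x. norm x ^ k *\<^sub>R \<phi> x))"
    using assms unfolding schwartz_def by (auto dest!: spec[of _ "[]"])
  then have "bounded (range \<phi>)"
    by (auto dest: spec[of _ 0])
  then show thesis
    using that unfolding bounded_iff by auto
qed

lemma schwartz_norm_le_decay:
  fixes \<phi> :: "real ^ 'n \<Rightarrow> complex"
  assumes "\<phi> \<in> schwartz"
  obtains C where "C \<ge> 0" "\<And>x. norm (\<phi> x) \<le> C * decay x"
proof -
  have bdd: "bounded (range (\<lambda>x. norm x ^ (2 * CARD('n)) *\<^sub>R \<phi> x))"
    using assms unfolding schwartz_def by (auto dest!: spec[of _ "[]"])
  obtain A where A: "\<And>x. norm (\<phi> x) \<le> A"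
    using schwartz_bounded[OF assms] by blast
  obtain B where B: "\<And>x. norm x ^ (2 * CARD('n)) * norm (\<phi> x) \<le> B"
    using bdd unfolding bounded_iff by auto
  have "0 \<le> A" "0 \<le> B"
    using order.trans[OF norm_ge_zero A] order.trans[OF mult_nonneg_nonneg B] by auto
  show thesis
    using norm_le_decay[OF A B] \<open>0 \<le> A\<close> \<open>0 \<le> B\<close> by (intro that[of "2 ^ CARD('n) * (A + B)"]) auto
qed

lemma integrable_norm_le_decay:
  fixes \<phi> :: "real ^ 'n \<Rightarrow> complex"
  assumes "\<phi> \<in> borel_measurable borel" and "\<And>x. norm (\<phi> x) \<le> C * decay x"
  shows "integrable lborel \<phi>"
proof (rule Bochner_Integration.integrable_bound)
  show "integrable lborel (\<lambda>x :: real ^ 'n. C * decay x)"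
    by (intro integrable_mult_right integrable_decay)
  show "AE x in lborel. norm (\<phi> x) \<le> norm (C * decay x)"
    using assms(2) by (auto intro!: AE_I2 order.trans[OF _ abs_ge_self])
qed (use assms in simp)

lemma schwartz_integrable: "\<phi> \<in> schwartz \<Longrightarrow> integrable lborel \<phi>"
  by (metis integrable_norm_le_decay schwartz_measurable schwartz_norm_le_decay)

lemma inv_fourier_eq_lborel:
  assumes [measurable]: "\<phi> \<in> borel_measurable borel"
  shows "inv_fourier \<phi> \<xi> = (LINT x|lborel. cis (2 * pi * (\<xi> \<bullet> x)) * \<phi> x)"
  unfolding inv_fourier_def by (rule integral_completion) measurable

lemma integrable_cis_mult:
  fixes \<phi> :: "'a::euclidean_space \<Rightarrow> complex"
  assumes "integrable lborel \<phi>"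
  shows "integrable lborel (\<lambda>x. cis (c * (\<xi> \<bullet> x)) * \<phi> x)"
proof (rule Bochner_Integration.integrable_bound[OF assms])
  have [measurable]: "\<phi> \<in> borel_measurable borel" using assms by auto
  show "(\<lambda>x. cis (c * (\<xi> \<bullet> x)) * \<phi> x) \<in> borel_measurable lborel"
    by measurable
qed (simp add: norm_mult)

section \<open>Derivatives under the inverse Fourier transform\<close>

lemma schwartz_has_vector_derivative:
  assumes "\<phi> \<in> schwartz"
  shows "((\<lambda>t. \<phi> (x + t *\<^sub>R axis i 1)) has_vector_derivative
      partial_deriv i \<phi> (x + s *\<^sub>R axis i 1)) (at s)"
proof -
  let ?g = "\<lambda>t. \<phi> ((x + s *\<^sub>R axis i 1) + t *\<^sub>R axis i 1)"
  have "(\<phi> \<circ> (\<lambda>t. (x + s *\<^sub>R axis i 1) + t *\<^sub>R axis i 1)) differentiable (at 0)"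
    by (rule differentiable_chain_at) (auto intro!: schwartz_differentiable[OF assms] derivative_intros)
  \<comment> \<open>The point 0 is written as \<open>s - s\<close> so that the chain rule with the
    shift by \<open>s\<close> carries the derivative from 0 to \<open>s\<close>.\<close>
  then have "(?g has_vector_derivative partial_deriv i \<phi> (x + s *\<^sub>R axis i 1)) (at (s - s))"
    unfolding partial_deriv_def o_def by (simp add: vector_derivative_works)
  then have "((?g \<circ> (\<lambda>t. t - s)) has_vector_derivative
      1 *\<^sub>R partial_deriv i \<phi> (x + s *\<^sub>R axis i 1)) (at s)"
    by (intro vector_diff_chain_at) (auto intro!: derivative_eq_intros)
  then show ?thesis
    by (simp add: o_def algebra_simps)
qed

lemma has_vector_derivative_at_0_tendsto:
  assumes "(f has_vector_derivative d) (at 0)"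
  shows "((\<lambda>t. (f t - f 0) /\<^sub>R t) \<longlongrightarrow> d) (at 0)"
proof -
  have "((\<lambda>t. norm (f (0 + t) - f 0 - t *\<^sub>R d) / norm t) \<longlongrightarrow> 0) (at 0)"
    using assms unfolding has_vector_derivative_def has_derivative_at by blast
  then have "((\<lambda>t. norm ((f t - f 0) /\<^sub>R t - d)) \<longlongrightarrow> 0) (at 0)"
  proof (rule Lim_transform_eventually)
    have "norm (f (0 + t) - f 0 - t *\<^sub>R d) / norm t = norm ((f t - f 0) /\<^sub>R t - d)" if "t \<noteq> 0" for t
    proof -
      have "(f t - f 0) /\<^sub>R t - d = (f (0 + t) - f 0 - t *\<^sub>R d) /\<^sub>R t"
        using that by (simp add: algebra_simps)
      then show ?thesis by (simp add: divide_inverse)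
    qed
    then show "\<forall>\<^sub>F t in at 0. norm (f (0 + t) - f 0 - t *\<^sub>R d) / norm t = norm ((f t - f 0) /\<^sub>R t - d)"
      by (auto simp: eventually_at_filter)
  qed
  then show ?thesis
    by (simp add: tendsto_norm_zero_iff LIM_zero_iff)
qed

text \<open>Integration by parts in the form of a limit computed twice. The integrals of character
  times difference quotient converge to the left side by dominated convergence; by translation
  invariance the quotient moves onto the character, which gives the right side.\<close>

lemma inv_fourier_partial_deriv:
  fixes \<phi> :: "real ^ 'n \<Rightarrow> complex"
  assumes \<phi>: "\<phi> \<in> schwartz"
  shows "inv_fourier (partial_deriv i \<phi>) \<xi> = - 2 * pi * \<i> * (\<xi> $ i) * inv_fourier \<phi> \<xi>"
proof (rule LIMSEQ_unique)
  define e :: "real ^ 'n" where "e = axis i 1"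
  define h where "h m = 1 / real (Suc m)" for m
  define q where "q m x = cis (2 * pi * (\<xi> \<bullet> x)) * ((\<phi> (h m *\<^sub>R e + x) - \<phi> x) /\<^sub>R h m)" for m x
  have h: "0 < h m" "h m \<le> 1" for m by (auto simp: h_def)
  have h0: "filterlim h (at 0) sequentially"
    unfolding h_def by real_asymp
  have [measurable]: "\<phi> \<in> borel_measurable borel" "partial_deriv i \<phi> \<in> borel_measurable borel"
    using \<phi> by (auto intro: schwartz_measurable schwartz_partial_deriv)
  obtain C where C: "C \<ge> 0" "\<And>x. norm (partial_deriv i \<phi> x) \<le> C * decay x"
    using schwartz_norm_le_decay[OF schwartz_partial_deriv[OF \<phi>]] by blast
  have deriv: "((\<lambda>t. \<phi> (x + t *\<^sub>R e)) has_vector_derivative partial_deriv i \<phi> (x + s *\<^sub>R e)) (at s)" for x s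
    unfolding e_def by (rule schwartz_has_vector_derivative[OF \<phi>])
  have "(\<lambda>m. LINT x|lborel. q m x) \<longlonglongrightarrow> (LINT x|lborel. cis (2 * pi * (\<xi> \<bullet> x)) * partial_deriv i \<phi> x)"
  proof (rule integral_dominated_convergence[where w = "\<lambda>x. C * (3 ^ CARD('n) * decay x)"])
    show "AE x in lborel. (\<lambda>m. q m x) \<longlonglongrightarrow> cis (2 * pi * (\<xi> \<bullet> x)) * partial_deriv i \<phi> x"
    proof (intro AE_I2)
      fix x
      have "((\<lambda>t. (\<phi> (x + t *\<^sub>R e) - \<phi> x) /\<^sub>R t) \<longlongrightarrow> partial_deriv i \<phi> x) (at 0)"
        using has_vector_derivative_at_0_tendsto[OF deriv[of x 0, simplified]] by simp
      then show "(\<lambda>m. q m x) \<longlonglongrightarrow> cis (2 * pi * (\<xi> \<bullet> x)) * partial_deriv i \<phi> x"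
        unfolding q_def add.commute[of _ x]
        by (intro tendsto_mult tendsto_const) (rule filterlim_compose[OF _ h0])
    qed
    show "AE x in lborel. norm (q m x) \<le> C * (3 ^ CARD('n) * decay x)" for m
    proof (intro AE_I2)
      fix x
      \<comment> \<open>Mean value inequality on the unit segment: as \<open>h m \<le> 1\<close>,
        all intermediate points are within distance 1 of x, so the majorant does not depend on
        \<open>m\<close>.\<close>
      have "norm (\<phi> (x + h m *\<^sub>R e) - \<phi> (x + 0 *\<^sub>R e)) \<le> C * (3 ^ CARD('n) * decay x) * norm (h m - 0)"
      proof (rule differentiable_bound[where S = "{0..1}"])
        fix s :: real assume s: "s \<in> {0..1}"
        show "((\<lambda>t. \<phi> (x + t *\<^sub>R e)) has_derivative (\<lambda>t. t *\<^sub>R partial_deriv i \<phi> (x + s *\<^sub>R e))) (at s within {0..1})"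
          using deriv has_derivative_at_withinI unfolding has_vector_derivative_def by blast
        have "norm (partial_deriv i \<phi> (x + s *\<^sub>R e)) \<le> C * decay (x + s *\<^sub>R e)"
          by (rule C)
        also have "\<dots> \<le> C * (3 ^ CARD('n) * decay x)"
          using s C(1) by (intro mult_left_mono decay_le_decay_shift) (auto simp: e_def)
        finally show "onorm (\<lambda>t. t *\<^sub>R partial_deriv i \<phi> (x + s *\<^sub>R e)) \<le> C * (3 ^ CARD('n) * decay x)"
          by (intro onorm_le) (simp add: mult.commute[of "\<bar>_\<bar>"] mult_right_mono)
      qed (use h[of m] in auto)
      moreover have "norm (q m x) = norm (\<phi> (x + h m *\<^sub>R e) - \<phi> (x + 0 *\<^sub>R e)) / h m"
        using h[of m] by (simp add: q_def norm_mult add.commute divide_inverse mult.commute)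
      ultimately show "norm (q m x) \<le> C * (3 ^ CARD('n) * decay x)"
        using h[of m] by (simp add: pos_divide_le_eq)
    qed
    show "q m \<in> borel_measurable lborel" for m unfolding q_def by measurable
  qed (use integrable_decay in auto)
  then show "(\<lambda>m. LINT x|lborel. q m x) \<longlonglongrightarrow> inv_fourier (partial_deriv i \<phi>) \<xi>"
    by (simp add: inv_fourier_eq_lborel)
  have int: "integrable lborel (\<lambda>x. cis (2 * pi * (\<xi> \<bullet> x)) * \<phi> x)"
    by (intro integrable_cis_mult schwartz_integrable \<phi>)
  have eq: "(LINT x|lborel. q m x) = ((cis (- (2 * pi * (\<xi> $ i)) * h m) - 1) /\<^sub>R h m) * inv_fourier \<phi> \<xi>" for m
  proof -
    let ?F = "\<lambda>x. cis (2 * pi * (\<xi> \<bullet> x)) * \<phi> x"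
    \<comment> \<open>The character at x is its value at the shifted point times a phase depending
      only on \<open>h m\<close>. The shift thus acts on the whole integrand and disappears after
      integration.\<close>
    have "q m x = (cis (- (2 * pi * (\<xi> $ i)) * h m) * ?F (h m *\<^sub>R e + x) - ?F x) /\<^sub>R h m" for x
    proof -
      have "cis (2 * pi * (\<xi> \<bullet> x)) = cis (- (2 * pi * (\<xi> $ i)) * h m) * cis (2 * pi * (\<xi> \<bullet> (h m *\<^sub>R e + x)))"
        unfolding cis_mult by (simp add: e_def inner_axis inner_add_right algebra_simps)
      then show ?thesis
        by (simp add: q_def algebra_simps)
    qed
    then have "(LINT x|lborel. q m x)
        = (LINT x|lborel. (cis (- (2 * pi * (\<xi> $ i)) * h m) * ?F (h m *\<^sub>R e + x) - ?F x) /\<^sub>R h m)"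
      by simp
    also have "\<dots> = (cis (- (2 * pi * (\<xi> $ i)) * h m) * (LINT x|lborel. ?F (h m *\<^sub>R e + x))
        - (LINT x|lborel. ?F x)) /\<^sub>R h m"
      using int lborel_integrable_translate[OF int, of "h m *\<^sub>R e"] by simp
    also have "(LINT x|lborel. ?F (h m *\<^sub>R e + x)) = (LINT x|lborel. ?F x)"
      by (rule lborel_integral_translate) measurable
    finally show ?thesis
      by (simp add: inv_fourier_eq_lborel algebra_simps)
  qed
  have "((\<lambda>t. (cis (- (2 * pi * (\<xi> $ i)) * t) - 1) /\<^sub>R t) \<longlongrightarrow> - 2 * pi * \<i> * (\<xi> $ i)) (at 0)"
  proof -
    have "((\<lambda>z. exp (\<i> * (- (2 * pi * (\<xi> $ i)) * z))) has_field_derivative - 2 * pi * \<i> * (\<xi> $ i)) (at (of_real 0))"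
      by (auto intro!: derivative_eq_intros simp: algebra_simps)
    from has_vector_derivative_at_0_tendsto[OF has_vector_derivative_real_field[OF this]]
    show ?thesis by (simp add: cis_conv_exp)
  qed
  then have "(\<lambda>m. (cis (- (2 * pi * (\<xi> $ i)) * h m) - 1) /\<^sub>R h m) \<longlonglongrightarrow> - 2 * pi * \<i> * (\<xi> $ i)"
    by (rule filterlim_compose[OF _ h0])
  then show "(\<lambda>m. LINT x|lborel. q m x) \<longlonglongrightarrow> - 2 * pi * \<i> * (\<xi> $ i) * inv_fourier \<phi> \<xi>"
    unfolding eq by (intro tendsto_mult tendsto_const)
qed

text \<open>Each derivative in direction i multiplies the transform by 2 pi
  |\<open>\<xi> $ i\<close>|, while every transform is bounded by the L^1 norm of the function
  transformed. Taking \<open>2 * CARD('n)\<close> derivatives gives the moment bound required by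
  \<open>norm_le_decay\<close>.\<close>

lemma integrable_inv_fourier:
  fixes \<phi> :: "real ^ 'n \<Rightarrow> complex"
  assumes \<phi>: "\<phi> \<in> schwartz"
  shows "integrable lborel (inv_fourier \<phi>)"
proof -
  let ?n = "CARD('n)"
  let ?D = "\<lambda>i k. (partial_deriv i ^^ k) \<phi>"
  have D: "?D i k \<in> schwartz" for i k
    by (induction k) (use \<phi> schwartz_partial_deriv in auto)
  have meas: "?D i k \<in> borel_measurable borel" for i k
    by (rule schwartz_measurable[OF D])
  have [measurable]: "\<phi> \<in> borel_measurable borel"
    by (rule schwartz_measurable[OF \<phi>])
  define M where "M i k = (LINT x|lborel. norm (?D i k x))" for i k
  have M: "norm (inv_fourier (?D i k) \<xi>) \<le> M i k" for i k \<xi>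
    unfolding inv_fourier_eq_lborel[OF meas] M_def
    by (rule order.trans[OF integral_norm_bound]) (simp add: norm_mult)
  have M0: "0 \<le> M i k" for i k
    by (simp add: M_def)
  have F: "norm (inv_fourier (?D i k) \<xi>) = (2 * pi * \<bar>\<xi> $ i\<bar>) ^ k * norm (inv_fourier \<phi> \<xi>)" for i k \<xi>
    by (induction k) (simp_all add: inv_fourier_partial_deriv[OF D] norm_mult)
  \<comment> \<open>The direction of differentiation will depend on \<open>\<xi>\<close>; summing
    over all directions makes the bound uniform.\<close>
  define B where "B = real ?n ^ (2 * ?n) * (\<Sum>i\<in>UNIV. M i (2 * ?n))"
  show ?thesis
  proof (rule integrable_norm_le_decay)
    show "inv_fourier \<phi> \<in> borel_measurable borel"
      unfolding inv_fourier_eq_lborel[OF \<open>\<phi> \<in> borel_measurable borel\<close>, abs_def] by measurable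
    fix \<xi> :: "real ^ 'n"

    \<comment> \<open>Choose the largest coordinate \<open>j\<close> of \<open>\<xi>\<close>: it
      controls the norm up to the factor \<open>CARD('n)\<close>.\<close>
    have "\<bar>\<xi> $ i\<bar> \<le> Max (range (\<lambda>i. \<bar>\<xi> $ i\<bar>))" for i by simp
    moreover have "Max (range (\<lambda>i. \<bar>\<xi> $ i\<bar>)) \<in> range (\<lambda>i. \<bar>\<xi> $ i\<bar>)"
      by (intro Max_in) auto
    then obtain j where "Max (range (\<lambda>i. \<bar>\<xi> $ i\<bar>)) = \<bar>\<xi> $ j\<bar>"
      by blast
    ultimately have j: "\<bar>\<xi> $ i\<bar> \<le> \<bar>\<xi> $ j\<bar>" for i by metis
    have "norm \<xi> \<le> (\<Sum>i\<in>UNIV. \<bar>\<xi> $ i\<bar>)"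
      by (rule norm_le_l1_cart)
    also have "\<dots> \<le> real ?n * \<bar>\<xi> $ j\<bar>"
      using sum_bounded_above[of UNIV "\<lambda>i. \<bar>\<xi> $ i\<bar>"] j by auto
    finally have "norm \<xi> ^ (2 * ?n) * norm (inv_fourier \<phi> \<xi>)
        \<le> (real ?n * \<bar>\<xi> $ j\<bar>) ^ (2 * ?n) * norm (inv_fourier \<phi> \<xi>)"
      by (intro mult_right_mono power_mono) auto
    \<comment> \<open>The factor 2 pi \<ge> 1 is inserted so that \<open>F\<close> turns the power
      into an iterated derivative.\<close>
    also have "\<dots> \<le> (real ?n * (2 * pi * \<bar>\<xi> $ j\<bar>)) ^ (2 * ?n) * norm (inv_fourier \<phi> \<xi>)"
      using pi_gt3 mult_right_mono[of 1 "2 * pi" "\<bar>\<xi> $ j\<bar>"]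
      by (intro mult_right_mono power_mono mult_left_mono) auto
    also have "\<dots> = real ?n ^ (2 * ?n) * norm (inv_fourier (?D j (2 * ?n)) \<xi>)"
      by (simp add: F power_mult_distrib)
    also have "\<dots> \<le> real ?n ^ (2 * ?n) * M j (2 * ?n)"
      using M by (intro mult_left_mono) auto
    also have "\<dots> \<le> B"
      unfolding B_def using M0 by (intro mult_left_mono member_le_sum) auto
    finally have "norm \<xi> ^ (2 * ?n) * norm (inv_fourier \<phi> \<xi>) \<le> B" .
    \<comment> \<open>No derivative is taken for \<open>k = 0\<close>, so any direction serves,
      including \<open>undefined\<close>.\<close>
    moreover have "norm (inv_fourier \<phi> \<xi>) \<le> M undefined 0"
      using M[where i = undefined and k = 0] by simp
    ultimately show "norm (inv_fourier \<phi> \<xi>) \<le> (2 ^ ?n * (M undefined 0 + B)) * decay \<xi>"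
      by (intro norm_le_decay)
  qed
qed

section \<open>The Bessel kernel as an average of heat kernels\<close>

definition gamma_density :: "real \<Rightarrow> real \<Rightarrow> real" where
  "gamma_density \<beta> t = indicator {0<..} t * (t powr (\<beta> - 1) * exp (- t) / Gamma \<beta>)"

text \<open>Kernel of the heat semigroup exp (t Delta). Under the normalization of
  \<open>inv_fourier\<close> it is the transform of exp (- 4 pi^2 t |\<xi>|^2).\<close>

definition heat_kernel :: "real \<Rightarrow> 'a::euclidean_space \<Rightarrow> real" where
  "heat_kernel t x = (4 * pi * t) powr - (DIM('a) / 2) * exp (- (norm x)\<^sup>2 / (4 * t))"

text \<open>For \<open>\<beta> = \<alpha> / 2\<close> this is the classical integral formula for the
  Bessel kernel. If \<open>\<beta> \<le> DIM('a) / 2\<close>, the integral diverges at x = 0 and the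
  Bochner integral returns 0 there; this concerns a single point.\<close>

definition subordinated_kernel :: "real \<Rightarrow> 'a::euclidean_space \<Rightarrow> real" where
  "subordinated_kernel \<beta> x = (LINT t|lborel. gamma_density \<beta> t * heat_kernel t x)"

lemma gamma_density_nonneg: "0 < \<beta> \<Longrightarrow> 0 \<le> gamma_density \<beta> t"
  by (simp add: gamma_density_def Gamma_real_pos less_imp_le)

lemma gamma_density_nonpos: "t \<le> 0 \<Longrightarrow> gamma_density \<beta> t = 0"
  by (simp add: gamma_density_def)

lemma gamma_density_measurable [measurable]: "gamma_density \<beta> \<in> borel_measurable borel"
  unfolding gamma_density_def[abs_def] by measurable

lemma heat_kernel_nonneg: "0 \<le> heat_kernel t x"
  by (simp add: heat_kernel_def)

lemma heat_kernel_measurable [measurable]: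
  "(\<lambda>p. heat_kernel (fst p) (snd p)) \<in> borel_measurable (borel \<Otimes>\<^sub>M borel)"
  unfolding heat_kernel_def[abs_def] by measurable

text \<open>Laplace transform of the Gamma distribution, obtained by substituting (1 + m) t in
  Euler's integral. Computing with nonnegative integrals delivers integrability and value at
  once.\<close>

lemma has_bochner_integral_gamma_density:
  assumes \<beta>: "0 < \<beta>" and m: "0 \<le> m"
  shows "has_bochner_integral lborel (\<lambda>t. gamma_density \<beta> t * exp (- m * t)) ((1 + m) powr - \<beta>)"
proof (rule has_bochner_integral_nn_integral)
  define c where "c = 1 + m"
  have c: "c > 0" using m by (simp add: c_def)
  have G: "Gamma \<beta> > 0" using \<beta> by (simp add: Gamma_real_pos)
  have pt: "indicator {0..} (0 + c * t) * (0 + c * t) powr (\<beta> - 1) / exp (0 + c * t)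
      = c powr (\<beta> - 1) * Gamma \<beta> * (gamma_density \<beta> t * exp (- m * t))" for t
  proof (cases "t > 0")
    case True
    have "exp (- t) * exp (- m * t) = 1 / exp (c * t)"
      by (simp add: c_def exp_minus exp_add algebra_simps divide_inverse)
    then show ?thesis
      using True c G by (simp add: gamma_density_def powr_mult field_simps)
  next
    case False
    then show ?thesis
      using c by (cases "t = 0") (auto simp: gamma_density_def mult_less_0_iff zero_le_mult_iff)
  qed
  have "ennreal (Gamma \<beta>)
      = ennreal c * (\<integral>\<^sup>+t. ennreal (c powr (\<beta> - 1) * Gamma \<beta> * (gamma_density \<beta> t * exp (- m * t))) \<partial>lborel)"
    unfolding Gamma_conv_nn_integral_real[OF \<beta>]
    by (subst nn_integral_real_affine[of _ c 0]) (use c in \<open>simp_all only: pt, simp_all\<close>)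
  also have "\<dots> = ennreal c * (ennreal (c powr (\<beta> - 1) * Gamma \<beta>) *
      (\<integral>\<^sup>+t. ennreal (gamma_density \<beta> t * exp (- m * t)) \<partial>lborel))"
  proof -
    have "0 \<le> c powr (\<beta> - 1) * Gamma \<beta>" using G by simp
    then show ?thesis
      by (simp only: ennreal_mult') (subst nn_integral_cmult, simp_all)
  qed
  also have "\<dots> = ennreal (c powr \<beta> * Gamma \<beta>) *
      (\<integral>\<^sup>+t. ennreal (gamma_density \<beta> t * exp (- m * t)) \<partial>lborel)"
  proof -
    have "c * (c powr (\<beta> - 1) * Gamma \<beta>) = c powr \<beta> * Gamma \<beta>"
      using c by (simp add: powr_diff)
    moreover have "ennreal (c * (c powr (\<beta> - 1) * Gamma \<beta>)) = ennreal c * ennreal (c powr (\<beta> - 1) * Gamma \<beta>)"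
      using c by (intro ennreal_mult') simp
    ultimately show ?thesis
      by (simp only: mult.assoc)
  qed
  finally have eq: "ennreal (Gamma \<beta>) = ennreal (c powr \<beta> * Gamma \<beta>) *
      (\<integral>\<^sup>+t. ennreal (gamma_density \<beta> t * exp (- m * t)) \<partial>lborel)" .
  have "ennreal (c powr - \<beta>) = ennreal (1 / (c powr \<beta> * Gamma \<beta>)) * ennreal (Gamma \<beta>)"
    using c G by (simp add: powr_minus field_simps flip: ennreal_mult')
  also have "\<dots> = (ennreal (1 / (c powr \<beta> * Gamma \<beta>)) * ennreal (c powr \<beta> * Gamma \<beta>)) *
      (\<integral>\<^sup>+t. ennreal (gamma_density \<beta> t * exp (- m * t)) \<partial>lborel)"
    by (subst eq) (simp only: mult.assoc)
  also have "ennreal (1 / (c powr \<beta> * Gamma \<beta>)) * ennreal (c powr \<beta> * Gamma \<beta>) = 1"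
    using c G by (subst ennreal_mult'[symmetric]) auto
  finally show "(\<integral>\<^sup>+t. ennreal (gamma_density \<beta> t * exp (- m * t)) \<partial>lborel) = ennreal ((1 + m) powr - \<beta>)"
    by (simp add: c_def)
qed (use gamma_density_nonneg[OF \<beta>] in auto)

lemma integrable_gamma_density: "0 < \<beta> \<Longrightarrow> integrable lborel (gamma_density \<beta>)"
  using has_bochner_integral_gamma_density[of \<beta> 0] by (auto simp: has_bochner_integral_iff)

lemma
  assumes t: "0 < t"
  shows integrable_heat_kernel: "integrable lborel (heat_kernel t :: 'a::euclidean_space \<Rightarrow> real)"
    and integral_heat_kernel: "(LINT x::'a|lborel. heat_kernel t x) = 1"
proof -
  have h: "heat_kernel t = (\<lambda>x::'a. (4 * pi * t) powr - (DIM('a) / 2) * exp (- (1 / (4 * t)) * (norm x)\<^sup>2))"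
    by (simp add: heat_kernel_def fun_eq_iff)
  show "integrable lborel (heat_kernel t :: 'a \<Rightarrow> real)"
    unfolding h using t by (intro integrable_mult_right integrable_gaussian) auto
  have "(LINT x::'a|lborel. heat_kernel t x)
      = (4 * pi * t) powr - (DIM('a) / 2) * (pi / (1 / (4 * t))) powr (DIM('a) / 2)"
    unfolding h using t by (subst integral_mult_right_zero, subst integral_gaussian) auto
  also have "pi / (1 / (4 * t)) = 4 * pi * t" by simp
  finally show "(LINT x::'a|lborel. heat_kernel t x) = 1"
    using t by (simp flip: powr_add)
qed

text \<open>Integrating over x first removes the heat kernel, which has mass 1, and leaves the
  integrable Gamma density.\<close>

lemma integrable_gamma_heat:
  assumes \<beta>: "0 < \<beta>"
  shows "integrable (lborel \<Otimes>\<^sub>M lborel)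
    (\<lambda>(t, x::'a::euclidean_space). gamma_density \<beta> t * heat_kernel t x)"
proof (rule lborel_pair.Fubini_integrable)
  have eq: "(LINT x::'a|lborel. norm (gamma_density \<beta> t * heat_kernel t x)) = gamma_density \<beta> t" for t
  proof (cases "t > 0")
    case True
    then show ?thesis
      using gamma_density_nonneg[OF \<beta>, of t] integral_heat_kernel[OF True, where 'a='a]
      by (simp add: abs_mult heat_kernel_nonneg)
  qed (simp add: gamma_density_nonpos)
  show "integrable lborel (\<lambda>t. LINT x::'a|lborel. norm (case (t, x) of (t, x) \<Rightarrow> gamma_density \<beta> t * heat_kernel t x))"
    using integrable_gamma_density[OF \<beta>] by (simp add: eq[simplified])
  have "integrable lborel (\<lambda>x::'a. gamma_density \<beta> t * heat_kernel t x)" for t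
    by (cases "t > 0") (auto simp: gamma_density_nonpos intro: integrable_heat_kernel)
  then show "AE t in lborel. integrable lborel (\<lambda>x::'a. case (t, x) of (t, x) \<Rightarrow> gamma_density \<beta> t * heat_kernel t x)"
    by simp
  show "(\<lambda>(t, x::'a). gamma_density \<beta> t * heat_kernel t x) \<in> borel_measurable (lborel \<Otimes>\<^sub>M lborel)"
    unfolding split_beta' by measurable
qed

lemma integrable_subordinated_kernel:
  assumes "0 < \<beta>"
  shows "integrable lborel (subordinated_kernel \<beta> :: 'a::euclidean_space \<Rightarrow> real)"
  using lborel_pair.integrable_snd[OF integrable_gamma_heat[OF assms]]
  unfolding subordinated_kernel_def[abs_def] .

lemma integrable_lborel_pair_scaleR:
  fixes f :: "'a::euclidean_space \<Rightarrow> real"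
    and g :: "'b::euclidean_space \<Rightarrow> 'c::{banach, second_countable_topology}"
  assumes f: "integrable lborel f" and g: "integrable lborel g"
  shows "integrable (lborel \<Otimes>\<^sub>M lborel) (\<lambda>(x, y). f x *\<^sub>R g y)"
proof (rule lborel_pair.Fubini_integrable)
  have [measurable]: "f \<in> borel_measurable borel" "g \<in> borel_measurable borel"
    using f g by auto
  show "(\<lambda>(x, y). f x *\<^sub>R g y) \<in> borel_measurable (lborel \<Otimes>\<^sub>M lborel)"
    unfolding split_beta' by measurable
qed (use f g in auto)

lemma
  fixes \<phi> :: "'a::euclidean_space \<Rightarrow> 'b::{banach, second_countable_topology}"
  assumes \<beta>: "0 < \<beta>" and [measurable]: "\<phi> \<in> borel_measurable borel"
    and bound: "\<And>x. norm (\<phi> x) \<le> B"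
  shows integrable_gamma_integral_heat_kernel:
      "integrable lborel (\<lambda>t. gamma_density \<beta> t *\<^sub>R (LINT x|lborel. heat_kernel t x *\<^sub>R \<phi> x))"
    and integral_subordinated_kernel:
      "(LINT x|lborel. subordinated_kernel \<beta> x *\<^sub>R \<phi> x)
        = (LINT t|lborel. gamma_density \<beta> t *\<^sub>R (LINT x|lborel. heat_kernel t x *\<^sub>R \<phi> x))"
proof -
  let ?f = "\<lambda>t x. (gamma_density \<beta> t * heat_kernel t x) *\<^sub>R \<phi> x"
  have int: "integrable (lborel \<Otimes>\<^sub>M lborel) (case_prod ?f)"
  proof (rule Bochner_Integration.integrable_bound)
    show "integrable (lborel \<Otimes>\<^sub>M lborel) (\<lambda>p. B * (case p of (t, x::'a) \<Rightarrow> gamma_density \<beta> t * heat_kernel t x))"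
      by (intro integrable_mult_right integrable_gamma_heat \<beta>)
    show "case_prod ?f \<in> borel_measurable (lborel \<Otimes>\<^sub>M lborel)"
      unfolding split_beta' by measurable
    have "norm (?f t x) \<le> norm (B * (gamma_density \<beta> t * heat_kernel t x))" for t x
      using mult_right_mono[OF order.trans[OF bound abs_ge_self[of B]], of "\<bar>gamma_density \<beta> t * heat_kernel t x\<bar>" x]
      by (simp add: abs_mult mult.commute)
    then show "AE p in lborel \<Otimes>\<^sub>M lborel. norm (case_prod ?f p)
        \<le> norm (B * (case p of (t, x::'a) \<Rightarrow> gamma_density \<beta> t * heat_kernel t x))"
      by (auto simp: split_beta')
  qed
  have inner: "(LINT x|lborel. ?f t x) = gamma_density \<beta> t *\<^sub>R (LINT x|lborel. heat_kernel t x *\<^sub>R \<phi> x)" for t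
    by (simp flip: scaleR_scaleR)
  show "integrable lborel (\<lambda>t. gamma_density \<beta> t *\<^sub>R (LINT x|lborel. heat_kernel t x *\<^sub>R \<phi> x))"
    using lborel_pair.integrable_fst[OF int] unfolding inner .
  \<comment> \<open>Pulling \<open>\<phi> x\<close> out of the integral over t requires that this
    integral converges, which is known only almost everywhere.\<close>
  have "AE x in lborel. integrable lborel (\<lambda>t. gamma_density \<beta> t * heat_kernel t (x::'a))"
    by (rule lborel_pair.AE_integrable_snd[OF integrable_gamma_heat[OF \<beta>]])
  then have "AE x in lborel. subordinated_kernel \<beta> x *\<^sub>R \<phi> x = (LINT t|lborel. ?f t x)"
    unfolding subordinated_kernel_def by eventually_elim simp
  moreover have "(\<lambda>x. subordinated_kernel \<beta> x *\<^sub>R \<phi> x) \<in> borel_measurable lborel"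
    using integrable_subordinated_kernel[OF \<beta>, where 'a='a] by measurable
  moreover have "(\<lambda>x. LINT t|lborel. ?f t x) \<in> borel_measurable lborel"
    using lborel_pair.integrable_snd[OF int] by (rule borel_measurable_integrable)
  ultimately have "(LINT x|lborel. subordinated_kernel \<beta> x *\<^sub>R \<phi> x) = (LINT x|lborel. LINT t|lborel. ?f t x)"
    by (intro integral_cong_AE)
  also have "\<dots> = (LINT t|lborel. LINT x|lborel. ?f t x)"
    by (rule lborel_pair.Fubini_integral[OF int])
  finally show "(LINT x|lborel. subordinated_kernel \<beta> x *\<^sub>R \<phi> x)
        = (LINT t|lborel. gamma_density \<beta> t *\<^sub>R (LINT x|lborel. heat_kernel t x *\<^sub>R \<phi> x))"
    unfolding inner .
qed

text \<open>Fubini shifts the inverse transform from \<open>\<phi>\<close> to the Gaussian, whose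
  transform is the heat kernel.\<close>

lemma integral_gaussian_inv_fourier:
  fixes \<phi> :: "real ^ 'n \<Rightarrow> complex"
  assumes t: "0 < t" and \<phi>: "integrable lborel \<phi>"
  shows "(LINT \<xi>|lborel. exp (- 4 * pi\<^sup>2 * t * (norm \<xi>)\<^sup>2) *\<^sub>R inv_fourier \<phi> \<xi>)
      = (LINT x|lborel. heat_kernel t x *\<^sub>R \<phi> x)"
proof -
  have [measurable]: "\<phi> \<in> borel_measurable borel" using \<phi> by auto
  let ?s = "4 * pi\<^sup>2 * t"
  have s: "?s > 0" using t by simp
  let ?E = "\<lambda>\<xi> :: real ^ 'n. exp (- ?s * (norm \<xi>)\<^sup>2)"
  let ?f = "\<lambda>\<xi> x. ?E \<xi> *\<^sub>R (cis (2 * pi * (\<xi> \<bullet> x)) * \<phi> x)"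
  have int: "integrable (lborel \<Otimes>\<^sub>M lborel) (case_prod ?f)"
  proof (rule Bochner_Integration.integrable_bound)
    show "integrable (lborel \<Otimes>\<^sub>M lborel) (\<lambda>(\<xi>, x). ?E \<xi> *\<^sub>R \<phi> x)"
      by (intro integrable_lborel_pair_scaleR integrable_gaussian s \<phi>)
    show "case_prod ?f \<in> borel_measurable (lborel \<Otimes>\<^sub>M lborel)"
      unfolding split_beta' by measurable
  qed (auto simp: norm_mult)
  have "(LINT \<xi>|lborel. ?E \<xi> *\<^sub>R inv_fourier \<phi> \<xi>) = (LINT \<xi>|lborel. LINT x|lborel. ?f \<xi> x)"
    by (simp add: inv_fourier_eq_lborel)
  also have "\<dots> = (LINT x|lborel. LINT \<xi>|lborel. ?f \<xi> x)"
    by (rule lborel_pair.Fubini_integral[OF int, symmetric])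
  also have "\<dots> = (LINT x|lborel. heat_kernel t x *\<^sub>R \<phi> x)"
  proof (intro Bochner_Integration.integral_cong refl)
    fix x
    have "(LINT \<xi>|lborel. ?f \<xi> x)
        = (LINT \<xi>|lborel. (cis (2 * pi * (x \<bullet> \<xi>)) * complex_of_real (?E \<xi>)) * \<phi> x)"
      by (simp add: scaleR_conv_of_real inner_commute mult_ac)
    also have "\<dots> = (LINT \<xi>|lborel. cis (2 * pi * (x \<bullet> \<xi>)) * complex_of_real (?E \<xi>)) * \<phi> x"
      by (rule integral_mult_left_zero)
    also have "(LINT \<xi>|lborel. cis (2 * pi * (x \<bullet> \<xi>)) * complex_of_real (?E \<xi>))
        = (pi / ?s) powr (CARD('n) / 2) * exp (- (2 * pi)\<^sup>2 * (norm x)\<^sup>2 / (4 * ?s))"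
      using integral_gaussian_fourier[OF s, of "2 * pi" x] by simp
    also have "pi / ?s = 1 / (4 * pi * t)"
      using t by (simp add: power2_eq_square)
    also have "(1 / (4 * pi * t)) powr (CARD('n) / 2) = (4 * pi * t) powr - (CARD('n) / 2)"
      using t by (simp only: powr_minus_divide powr_divide powr_one_eq_one)
    also have "- (2 * pi)\<^sup>2 * (norm x)\<^sup>2 / (4 * ?s) = - (norm x)\<^sup>2 / (4 * t)"
      using t by (simp add: power2_eq_square field_simps)
    finally show "(LINT \<xi>|lborel. ?f \<xi> x) = heat_kernel t x *\<^sub>R \<phi> x"
      by (simp add: heat_kernel_def scaleR_conv_of_real)
  qed
  finally show ?thesis by simp
qed

text \<open>The multiplier is the Laplace transform of the Gamma density at m = 4 pi^2 |\<xi>|^2.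
  After exchanging the integrals, the Gaussian identity applies for each t > 0, and the average over
  t rebuilds the kernel.\<close>

lemma integral_bessel_multiplier_inv_fourier:
  fixes \<phi> :: "real ^ 'n \<Rightarrow> complex"
  assumes \<beta>: "0 < \<beta>" and \<phi>: "\<phi> \<in> schwartz"
  shows "(LINT \<xi>|lborel. (1 + 4 * pi\<^sup>2 * (norm \<xi>)\<^sup>2) powr - \<beta> *\<^sub>R inv_fourier \<phi> \<xi>)
      = (LINT x|lborel. subordinated_kernel \<beta> x *\<^sub>R \<phi> x)"
proof -
  let ?E = "\<lambda>t (\<xi> :: real ^ 'n). exp (- 4 * pi\<^sup>2 * t * (norm \<xi>)\<^sup>2)"
  let ?f = "\<lambda>t \<xi>. (gamma_density \<beta> t * ?E t \<xi>) *\<^sub>R inv_fourier \<phi> \<xi>"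
  note intF = integrable_inv_fourier[OF \<phi>]
  have [measurable]: "inv_fourier \<phi> \<in> borel_measurable borel" using intF by auto
  have [measurable]: "\<phi> \<in> borel_measurable borel" by (rule schwartz_measurable[OF \<phi>])
  have int: "integrable (lborel \<Otimes>\<^sub>M lborel) (case_prod ?f)"
  proof (rule Bochner_Integration.integrable_bound)
    show "integrable (lborel \<Otimes>\<^sub>M lborel) (\<lambda>(t, \<xi>). gamma_density \<beta> t *\<^sub>R inv_fourier \<phi> \<xi>)"
      by (intro integrable_lborel_pair_scaleR integrable_gamma_density \<beta> intF)
    show "case_prod ?f \<in> borel_measurable (lborel \<Otimes>\<^sub>M lborel)"
      unfolding split_beta' by measurable
    \<comment> \<open>For t > 0 the Gaussian is at most 1; for t \<le> 0, where it may exceed 1, the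
      Gamma density vanishes.\<close>
    have "norm (?f t \<xi>) \<le> norm (gamma_density \<beta> t *\<^sub>R inv_fourier \<phi> \<xi>)" for t \<xi>
    proof (cases "t > 0")
      case True
      then have "norm (gamma_density \<beta> t * ?E t \<xi>) \<le> norm (gamma_density \<beta> t)"
        by (simp add: abs_mult mult_left_le)
      then show ?thesis
        by (simp add: mult_right_mono)
    qed (simp add: gamma_density_nonpos)
    then show "AE p in lborel \<Otimes>\<^sub>M lborel. norm (case_prod ?f p)
        \<le> norm (case p of (t, \<xi>) \<Rightarrow> gamma_density \<beta> t *\<^sub>R inv_fourier \<phi> \<xi>)"
      by (auto simp: split_beta')
  qed
  have "(LINT t|lborel. ?f t \<xi>) = (1 + 4 * pi\<^sup>2 * (norm \<xi>)\<^sup>2) powr - \<beta> *\<^sub>R inv_fourier \<phi> \<xi>" for \<xi>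
  proof -
    have "has_bochner_integral lborel (\<lambda>t. gamma_density \<beta> t * ?E t \<xi>) ((1 + 4 * pi\<^sup>2 * (norm \<xi>)\<^sup>2) powr - \<beta>)"
      using has_bochner_integral_gamma_density[OF \<beta>, of "4 * pi\<^sup>2 * (norm \<xi>)\<^sup>2"] by (simp add: mult_ac)
    then show ?thesis
      by (simp add: has_bochner_integral_iff)
  qed
  then have "(LINT \<xi>|lborel. (1 + 4 * pi\<^sup>2 * (norm \<xi>)\<^sup>2) powr - \<beta> *\<^sub>R inv_fourier \<phi> \<xi>)
      = (LINT \<xi>|lborel. LINT t|lborel. ?f t \<xi>)"
    by simp
  also have "\<dots> = (LINT t|lborel. LINT \<xi>|lborel. ?f t \<xi>)"
    by (rule lborel_pair.Fubini_integral[OF int])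
  also have "\<dots> = (LINT t|lborel. gamma_density \<beta> t *\<^sub>R (LINT x|lborel. heat_kernel t x *\<^sub>R \<phi> x))"
  proof (intro Bochner_Integration.integral_cong refl)
    fix t
    show "(LINT \<xi>|lborel. ?f t \<xi>) = gamma_density \<beta> t *\<^sub>R (LINT x|lborel. heat_kernel t x *\<^sub>R \<phi> x)"
    proof (cases "t > 0")
      case True
      then show ?thesis
        using integral_gaussian_inv_fourier[OF True schwartz_integrable[OF \<phi>]]
        by (simp flip: scaleR_scaleR)
    qed (simp add: gamma_density_nonpos)
  qed
  also have "(LINT t|lborel. gamma_density \<beta> t *\<^sub>R (LINT x|lborel. heat_kernel t x *\<^sub>R \<phi> x))
      = (LINT x|lborel. subordinated_kernel \<beta> x *\<^sub>R \<phi> x)"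
    using schwartz_bounded[OF \<phi>] integral_subordinated_kernel[OF \<beta>, of \<phi>] by simp metis
  finally show ?thesis .
qed

text \<open>Provides a witness for the choice in \<open>bessel_kernel\<close>, which makes the
  defining property of that kernel available.\<close>

lemma distr_is_function_subordinated_kernel:
  assumes "0 < \<alpha>"
  shows "distr_is_function (inv_fourier_distr (regular_distr
      (\<lambda>\<xi>::real ^ 'n. (1 + 4 * pi\<^sup>2 * (norm \<xi>)\<^sup>2) powr (- \<alpha> / 2)))) (subordinated_kernel (\<alpha> / 2))"
    (is "distr_is_function ?T ?G")
  unfolding distr_is_function_def
proof (intro conjI ballI)
  have \<beta>: "0 < \<alpha> / 2" using assms by simp
  have intG: "integrable lborel ?G" by (rule integrable_subordinated_kernel[OF \<beta>])
  then have [measurable]: "?G \<in> borel_measurable borel" by auto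
  show "locally_integrable ?G"
    unfolding locally_integrable_def set_integrable_def
  proof (intro allI impI integrable_mult_indicator)
    show "integrable lebesgue ?G"
      using intG by (subst integrable_completion) auto
  qed (simp add: fmeasurableD lmeasurable_compact)
  fix \<phi> :: "real ^ 'n \<Rightarrow> complex" assume \<phi>: "\<phi> \<in> schwartz"
  have [measurable]: "\<phi> \<in> borel_measurable borel" by (rule schwartz_measurable[OF \<phi>])
  have [measurable]: "inv_fourier \<phi> \<in> borel_measurable borel"
    using integrable_inv_fourier[OF \<phi>] by auto
  obtain C where C: "\<And>x. norm (\<phi> x) \<le> C"
    using schwartz_bounded[OF \<phi>] by blast
  then have "0 \<le> C"
    using order.trans[OF norm_ge_zero] by blast
  with C have bound: "norm (of_real (?G x) * \<phi> x) \<le> norm (C * ?G x)" for x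
    using mult_right_mono[of "norm (\<phi> x)" C "\<bar>?G x\<bar>"]
    by (simp add: norm_mult abs_mult mult.commute)
  have meas: "(\<lambda>x. of_real (?G x) * \<phi> x) \<in> borel_measurable lborel"
    by measurable
  have "integrable lborel (\<lambda>x. of_real (?G x) * \<phi> x)"
  proof (rule Bochner_Integration.integrable_bound)
    show "integrable lborel (\<lambda>x. C * ?G x)"
      by (intro integrable_mult_right intG)
  qed (use bound meas in simp_all)
  with meas show "integrable lebesgue (\<lambda>x. of_real (?G x) * \<phi> x)"
    using integrable_completion by blast
  have mult: "(\<lambda>\<xi>. of_real ((1 + 4 * pi\<^sup>2 * (norm \<xi>)\<^sup>2) powr (- \<alpha> / 2)) * inv_fourier \<phi> \<xi>)
      \<in> borel_measurable lborel"
    by measurable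
  have "?T \<phi> = (LINT \<xi>|lborel. of_real ((1 + 4 * pi\<^sup>2 * (norm \<xi>)\<^sup>2) powr (- \<alpha> / 2)) * inv_fourier \<phi> \<xi>)"
    unfolding inv_fourier_distr_def regular_distr_def by (rule integral_completion[OF mult])
  also have "\<dots> = (LINT \<xi>|lborel. (1 + 4 * pi\<^sup>2 * (norm \<xi>)\<^sup>2) powr - (\<alpha> / 2) *\<^sub>R inv_fourier \<phi> \<xi>)"
    by (simp only: scaleR_conv_of_real minus_divide_left)
  also have "\<dots> = (LINT x|lborel. ?G x *\<^sub>R \<phi> x)"
    by (rule integral_bessel_multiplier_inv_fourier[OF \<beta> \<phi>])
  also have "\<dots> = regular_distr ?G \<phi>"
    unfolding regular_distr_def scaleR_conv_of_real by (rule integral_completion[symmetric]) measurable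
  finally show "?T \<phi> = regular_distr ?G \<phi>" .
qed

section \<open>Gaussians as test functions\<close>

lemma power_le_fact_mult_exp:
  fixes u :: real
  assumes "0 \<le> u"
  shows "u ^ m \<le> fact m * exp u"
proof -
  have "(\<Sum>k\<in>{m}. u ^ k /\<^sub>R fact k) \<le> (\<Sum>k. u ^ k /\<^sub>R fact k)"
    using assms by (intro sum_le_suminf summable_exp_generic) auto
  then show ?thesis
    by (simp add: exp_def field_simps)
qed

lemma real_polynomial_function_derivative_along:
  fixes P :: "'a::real_normed_vector \<Rightarrow> real"
  assumes "real_polynomial_function P"
  obtains P' where "real_polynomial_function P'"
    and "\<And>x. ((\<lambda>t. P (x + t *\<^sub>R e)) has_real_derivative P' x) (at 0)"
proof -
  have "\<exists>P'. real_polynomial_function P' \<and>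
      (\<forall>x. ((\<lambda>t. P (x + t *\<^sub>R e)) has_real_derivative P' x) (at 0))"
    using assms
  proof induction
    case (linear f)
    then interpret bounded_linear f .
    have "((\<lambda>t. f (x + t *\<^sub>R e)) has_real_derivative f e) (at 0)" for x
      by (auto simp: add scaleR intro!: derivative_eq_intros)
    then show ?case by (intro exI[of _ "\<lambda>_. f e"]) auto
  next
    case (const c)
    then show ?case by (intro exI[of _ "\<lambda>_. 0"]) auto
  next
    case (add f g)
    then obtain f' g' where "real_polynomial_function f'" "real_polynomial_function g'"
      "\<And>x. ((\<lambda>t. f (x + t *\<^sub>R e)) has_real_derivative f' x) (at 0)"
      "\<And>x. ((\<lambda>t. g (x + t *\<^sub>R e)) has_real_derivative g' x) (at 0)" by blast
    then show ?case
      by (intro exI[of _ "\<lambda>x. f' x + g' x"]) (auto intro!: derivative_intros)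
  next
    case (mult f g)
    then obtain f' g' where "real_polynomial_function f'" "real_polynomial_function g'"
      "\<And>x. ((\<lambda>t. f (x + t *\<^sub>R e)) has_real_derivative f' x) (at 0)"
      "\<And>x. ((\<lambda>t. g (x + t *\<^sub>R e)) has_real_derivative g' x) (at 0)" by blast
    with mult.hyps show ?case
      by (intro exI[of _ "\<lambda>x. f' x * g x + g' x * f x"]) (auto intro!: derivative_eq_intros)
  qed
  then show thesis using that by blast
qed

lemma real_polynomial_function_growth:
  fixes P :: "'a::real_normed_vector \<Rightarrow> real"
  assumes "real_polynomial_function P"
  obtains C m where "C \<ge> 0" "\<And>x. \<bar>P x\<bar> \<le> C * (1 + norm x) ^ m"
proof -
  have "\<exists>C m. C \<ge> 0 \<and> (\<forall>x. \<bar>P x\<bar> \<le> C * (1 + norm x) ^ m)"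
    using assms
  proof induction
    case (linear f)
    then obtain K where "K \<ge> 0" and K: "\<And>x. norm (f x) \<le> norm x * K"
      using bounded_linear.nonneg_bounded by blast
    have "\<bar>f x\<bar> \<le> K * (1 + norm x) ^ 1" for x
      using K[of x] \<open>K \<ge> 0\<close> by (simp add: algebra_simps)
    with \<open>K \<ge> 0\<close> show ?case by blast
  next
    case (const c)
    then show ?case by (intro exI[of _ "\<bar>c\<bar>"] exI[of _ 0]) auto
  next
    case (add f g)
    then obtain C m D k where *: "C \<ge> 0" "D \<ge> 0"
      "\<And>x. \<bar>f x\<bar> \<le> C * (1 + norm x) ^ m" "\<And>x. \<bar>g x\<bar> \<le> D * (1 + norm x) ^ k" by blast
    \<comment> \<open>The exponent \<open>m + k\<close> dominates both \<open>m\<close> and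
      \<open>k\<close> since the base 1 + |x| is at least 1.\<close>
    have "\<bar>f x + g x\<bar> \<le> (C + D) * (1 + norm x) ^ (m + k)" for x
    proof -
      have "C * (1 + norm x) ^ m \<le> C * (1 + norm x) ^ (m + k)"
        "D * (1 + norm x) ^ k \<le> D * (1 + norm x) ^ (m + k)"
        using * by (auto intro!: mult_left_mono power_increasing)
      then show ?thesis
        using *(3)[of x] *(4)[of x] by (simp add: distrib_right)
    qed
    with * show ?case by (intro exI[of _ "C + D"] exI[of _ "m + k"]) auto
  next
    case (mult f g)
    then obtain C m D k where *: "C \<ge> 0" "D \<ge> 0"
      "\<And>x. \<bar>f x\<bar> \<le> C * (1 + norm x) ^ m" "\<And>x. \<bar>g x\<bar> \<le> D * (1 + norm x) ^ k" by blast
    have "\<bar>f x * g x\<bar> \<le> (C * D) * (1 + norm x) ^ (m + k)" for x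
    proof -
      have "\<bar>f x\<bar> * \<bar>g x\<bar> \<le> (C * (1 + norm x) ^ m) * (D * (1 + norm x) ^ k)"
        using * by (intro mult_mono) auto
      then show ?thesis
        by (simp add: abs_mult power_add mult_ac)
    qed
    with * show ?case by (intro exI[of _ "C * D"] exI[of _ "m + k"]) auto
  qed
  then show thesis using that by blast
qed

text \<open>Polynomial multiples of a fixed Gaussian are closed under partial derivatives, which is
  the induction step for all multi-indices.\<close>

lemma partial_deriv_polynomial_gaussian:
  fixes a :: "real ^ 'n"
  assumes "real_polynomial_function P"
  obtains Q where "real_polynomial_function Q"
    and "partial_deriv i (\<lambda>x. complex_of_real (P x * exp (- (norm (x - a))\<^sup>2)))
      = (\<lambda>x. complex_of_real (Q x * exp (- (norm (x - a))\<^sup>2)))"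
proof -
  obtain P' where P': "real_polynomial_function P'"
    "\<And>x. ((\<lambda>t. P (x + t *\<^sub>R axis i 1)) has_real_derivative P' x) (at 0)"
    using real_polynomial_function_derivative_along[OF assms] by blast
  \<comment> \<open>Product rule: the exponent has derivative - 2 (\<open>x $ i\<close> -
    \<open>a $ i\<close>) in direction i.\<close>
  define Q where "Q x = P' x - 2 * (x $ i - a $ i) * P x" for x
  have "real_polynomial_function (\<lambda>x :: real ^ 'n. x $ i)"
    by (intro real_polynomial_function.intros(1) bounded_linear_vec_nth)
  then have "real_polynomial_function Q"
    unfolding Q_def[abs_def] using assms P'(1)
    by (intro real_polynomial_function_diff real_polynomial_function.intros(2,4))
  moreover have "partial_deriv i (\<lambda>x. complex_of_real (P x * exp (- (norm (x - a))\<^sup>2))) x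
      = complex_of_real (Q x * exp (- (norm (x - a))\<^sup>2))" for x
  proof -
    have sq: "(norm (x + t *\<^sub>R axis i 1 - a))\<^sup>2 = (norm (x - a))\<^sup>2 + 2 * t * (x $ i - a $ i) + t\<^sup>2" for t
    proof -
      have "x + t *\<^sub>R axis i 1 - a = (x - a) + t *\<^sub>R axis i 1" by simp
      then show ?thesis
        by (simp only: power2_norm_eq_inner inner_add_left inner_add_right inner_scaleR_left inner_scaleR_right
            inner_axis_axis inner_axis inner_axis')
          (simp add: power2_eq_square algebra_simps)
    qed
    have "((\<lambda>t. P (x + t *\<^sub>R axis i 1) * exp (- (norm (x + t *\<^sub>R axis i 1 - a))\<^sup>2))
        has_real_derivative Q x * exp (- (norm (x - a))\<^sup>2)) (at 0)"
      unfolding sq using P'(2)[of x] by (auto intro!: derivative_eq_intros simp: Q_def algebra_simps)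
    then show ?thesis
      unfolding partial_deriv_def
      by (intro vector_derivative_at has_vector_derivative_of_real)
        (simp add: has_real_derivative_iff_has_vector_derivative)
  qed
  ultimately show thesis using that by blast
qed

text \<open>Polynomial growth is traded for a multiple of exp (1 + |x|), and the Gaussian absorbs
  this because |x| - |x - a|^2 \<le> 1 + |a|.\<close>

lemma bounded_polynomial_gaussian:
  fixes a :: "'a::real_normed_vector"
  assumes "real_polynomial_function P"
  shows "bounded (range (\<lambda>x. norm x ^ k *\<^sub>R complex_of_real (P x * exp (- (norm (x - a))\<^sup>2))))"
proof -
  obtain C m where C: "C \<ge> 0" "\<And>x. \<bar>P x\<bar> \<le> C * (1 + norm x) ^ m"
    using real_polynomial_function_growth[OF assms] by blast
  have "norm (norm x ^ k *\<^sub>R complex_of_real (P x * exp (- (norm (x - a))\<^sup>2)))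
      \<le> C * (fact (k + m) * exp (2 + norm a))" for x
  proof -
    let ?s = "norm (x - a)"
    have "norm x ^ k * \<bar>P x\<bar> \<le> (1 + norm x) ^ k * (C * (1 + norm x) ^ m)"
      by (intro mult_mono power_mono C) auto
    also have "\<dots> = C * (1 + norm x) ^ (k + m)"
      by (simp add: power_add)
    also have "\<dots> \<le> C * (fact (k + m) * exp (1 + norm x))"
      by (intro mult_left_mono power_le_fact_mult_exp C) auto
    finally have "norm x ^ k * \<bar>P x\<bar> * exp (- ?s\<^sup>2) \<le> C * (fact (k + m) * exp (1 + norm x)) * exp (- ?s\<^sup>2)"
      by (rule mult_right_mono) simp
    also have "\<dots> = C * (fact (k + m) * exp (1 + norm x - ?s\<^sup>2))"
      by (simp add: exp_diff exp_minus divide_inverse)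
    also have "\<dots> \<le> C * (fact (k + m) * exp (2 + norm a))"
    proof -
      have "norm x \<le> ?s + norm a"
        using norm_triangle_ineq[of "x - a" a] by simp
      moreover have "2 * ?s \<le> 1 + ?s\<^sup>2"
        using zero_le_power2[of "?s - 1"] by (simp add: power2_eq_square algebra_simps)
      then have "?s \<le> 1 + ?s\<^sup>2"
        using norm_ge_zero[of "x - a"] by linarith
      ultimately show ?thesis
        using C by (intro mult_left_mono) auto
    qed
    finally show ?thesis by (simp add: norm_mult mult.assoc)
  qed
  then show ?thesis
    unfolding bounded_iff by blast
qed

lemma schwartz_gaussian:
  fixes a :: "real ^ 'n"
  shows "(\<lambda>x. complex_of_real (exp (- (norm (x - a))\<^sup>2))) \<in> schwartz"
proof -
  let ?g = "\<lambda>P x. complex_of_real (P x * exp (- (norm (x - a))\<^sup>2))"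
  have iter: "\<exists>Q. real_polynomial_function Q \<and> foldr partial_deriv is (?g (\<lambda>_. 1)) = ?g Q" for "is"
  proof (induction "is")
    case Nil
    then show ?case by (intro exI[of _ "\<lambda>_. 1"]) auto
  next
    case (Cons i "is")
    then obtain Q where "real_polynomial_function Q" "foldr partial_deriv is (?g (\<lambda>_. 1)) = ?g Q"
      by blast
    moreover obtain R where "real_polynomial_function R" "partial_deriv i (?g Q) = ?g R"
      using partial_deriv_polynomial_gaussian[OF \<open>real_polynomial_function Q\<close>] .
    ultimately show ?case
      by (intro exI[of _ R]) (simp only: foldr_Cons comp_apply simp_thms)
  qed
  have diff: "?g Q differentiable (at x)" if "real_polynomial_function Q" for Q x
  proof -
    have "(\<lambda>x. exp (- (norm (x - a))\<^sup>2)) differentiable (at x)"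
      unfolding power2_norm_eq_inner differentiable_def by (rule exI) (rule derivative_intros)+
    then have "(\<lambda>x. Q x * exp (- (norm (x - a))\<^sup>2)) differentiable (at x)"
      by (rule differentiable_mult[OF differentiable_at_real_polynomial_function[OF that]])
    then show ?thesis
      unfolding differentiable_def using has_derivative_of_real by blast
  qed
  show ?thesis
    unfolding schwartz_def mem_Collect_eq
  proof (intro allI)
    fix "is" :: "'n list"
    obtain Q where Q: "real_polynomial_function Q" "foldr partial_deriv is (?g (\<lambda>_. 1)) = ?g Q"
      using iter by blast
    then show "(\<forall>x. foldr partial_deriv is (\<lambda>x. complex_of_real (exp (- (norm (x - a))\<^sup>2))) differentiable at x) \<and>
        (\<forall>k. bounded (range (\<lambda>x. norm x ^ k *\<^sub>R
          foldr partial_deriv is (\<lambda>x. complex_of_real (exp (- (norm (x - a))\<^sup>2))) x)))"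
      using diff[OF Q(1)] bounded_polynomial_gaussian[OF Q(1)] by (simp only: mult_1_left) blast
  qed
qed

section \<open>Lower bounds for the kernel far from the origin\<close>

lemma heat_kernel_lower_bound:
  fixes a x :: "'a::euclidean_space"
  assumes r: "1 \<le> norm a" and t: "norm a \<le> t" "t \<le> norm a + 1" and x: "norm (x - a) \<le> 1"
  shows "(4 * pi * (norm a + 1)) powr - (DIM('a) / 2) * exp (- (norm a + 3) / 4) \<le> heat_kernel t x"
  unfolding heat_kernel_def
proof (rule mult_mono)
  let ?r = "norm a"
  have "0 < t" using r t by simp
  then show "(4 * pi * (?r + 1)) powr - (DIM('a) / 2) \<le> (4 * pi * t) powr - (DIM('a) / 2)"
    using t by (intro powr_mono2') auto
  have "norm x \<le> ?r + 1"
    using norm_triangle_ineq[of "x - a" a] x by simp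
  then have "(norm x)\<^sup>2 \<le> (?r + 1)\<^sup>2" by (intro power_mono) auto
  \<comment> \<open>Here |a| \<ge> 1 is used: r^2 + 2 r + 1 \<le> r^2 + 3 r. Splitting off the
    factor r \<le> t lets t cancel in the exponent.\<close>
  also have "\<dots> \<le> (?r + 3) * ?r"
    using r by (simp add: power2_eq_square algebra_simps)
  also have "\<dots> \<le> (?r + 3) * t"
    using t by (intro mult_left_mono) auto
  finally have "(norm x)\<^sup>2 / (4 * t) \<le> (?r + 3) / 4"
    using \<open>0 < t\<close> by (simp add: field_simps)
  then show "exp (- (?r + 3) / 4) \<le> exp (- (norm x)\<^sup>2 / (4 * t))"
    by simp
qed auto

text \<open>Since t \<ge> 1 and \<open>\<beta> - 1 > - 1\<close>, the power of t is at least 1 / t,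
  uniformly in \<open>\<beta>\<close>.\<close>

lemma gamma_density_lower_bound:
  assumes \<beta>: "0 < \<beta>" and r: "1 \<le> r" "r \<le> t" "t \<le> r + 1"
  shows "exp (- (r + 1)) / ((r + 1) * Gamma \<beta>) \<le> gamma_density \<beta> t"
proof -
  have "inverse (r + 1) \<le> inverse t" using r by (intro le_imp_inverse_le) auto
  also have "inverse t = t powr (- 1)" using r by (simp add: powr_minus)
  also have "\<dots> \<le> t powr (\<beta> - 1)" using \<beta> r by (intro powr_mono) auto
  finally have "inverse (r + 1) * exp (- (r + 1)) \<le> t powr (\<beta> - 1) * exp (- t)"
    using r by (intro mult_mono) auto
  then have "inverse (r + 1) * exp (- (r + 1)) / Gamma \<beta> \<le> t powr (\<beta> - 1) * exp (- t) / Gamma \<beta>"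
    using Gamma_real_pos[OF \<beta>] by (intro divide_right_mono) auto
  then show ?thesis
    using r by (simp add: gamma_density_def divide_inverse mult_ac)
qed

text \<open>Only t in [r, r + 1] and x in the unit ball around a are kept, where r = |a|. The Gamma
  density contributes exp (- r) and the heat kernel exp (- r / 4), hence the rate 5/4. Taking t near
  r / 2 would give rate 1, but any rate below 2 is enough for the potential.\<close>

lemma subordinated_kernel_lower_bound:
  assumes \<beta>: "0 < \<beta>"
  obtains c where "c > 0"
    and "\<And>a::'a::euclidean_space. 1 \<le> norm a \<Longrightarrow>
      c * (norm a + 1) powr - (1 + DIM('a) / 2) * exp (- (5 / 4) * norm a)
      \<le> (LINT x|lborel. subordinated_kernel \<beta> x * exp (- (norm (x - a))\<^sup>2))"
proof -
  define v where "v = measure lborel (ball (0::'a) 1)"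
  have v: "v > 0" by (simp add: v_def content_ball)
  have G: "Gamma \<beta> > 0" by (rule Gamma_real_pos[OF \<beta>])
  \<comment> \<open>Collects the factors independent of r: from the Gamma density, from the heat
    kernel, the minimum exp (- 1) of the Gaussian on the unit ball, and the volume \<open>v\<close>
    of that ball.\<close>
  define c where "c = exp (- 1) / Gamma \<beta> * ((4 * pi) powr - (DIM('a) / 2) * exp (- (3 / 4)) * exp (- 1) * v)"
  show thesis
  proof (rule that)
    show "c > 0" using v G by (simp add: c_def)
    fix a :: 'a assume r: "1 \<le> norm a"
    let ?r = "norm a"
    let ?\<phi> = "\<lambda>x. exp (- (norm (x - a))\<^sup>2)"
    define H where "H t = (LINT x|lborel. heat_kernel t x * ?\<phi> x)" for t
    define h where "h = (4 * pi * (?r + 1)) powr - (DIM('a) / 2) * exp (- (?r + 3) / 4) * exp (- 1) * v"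
    define g where "g = exp (- (?r + 1)) / ((?r + 1) * Gamma \<beta>)"
    have h0: "0 \<le> h" and g0: "0 \<le> g" using v G r by (auto simp: h_def g_def)
    have H0: "0 \<le> H t" for t
      unfolding H_def by (intro integral_nonneg_AE AE_I2) (simp add: heat_kernel_nonneg)
    have H: "h \<le> H t" if t: "?r \<le> t" "t \<le> ?r + 1" for t
    proof -
      let ?k = "(4 * pi * (?r + 1)) powr - (DIM('a) / 2) * exp (- (?r + 3) / 4) * exp (- 1)"
      have "integrable lborel (\<lambda>x::'a. heat_kernel t x * ?\<phi> x)"
      proof (rule Bochner_Integration.integrable_bound)
        show "integrable lborel (heat_kernel t :: 'a \<Rightarrow> real)"
          using t r by (intro integrable_heat_kernel) auto
        then have [measurable]: "(heat_kernel t :: 'a \<Rightarrow> real) \<in> borel_measurable borel" by auto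
        show "(\<lambda>x::'a. heat_kernel t x * ?\<phi> x) \<in> borel_measurable lborel" by measurable
      qed (auto simp: abs_mult heat_kernel_nonneg intro!: mult_left_le)
      moreover have "?k * indicator (ball a 1) x \<le> heat_kernel t x * ?\<phi> x" for x
      proof (cases "x \<in> ball a 1")
        case True
        then have x: "norm (x - a) \<le> 1" by (simp add: dist_norm norm_minus_commute)
        then have "exp (- 1) \<le> ?\<phi> x" by (simp add: power_le_one)
        with heat_kernel_lower_bound[OF r t x] show ?thesis
          using True by (simp only: indicator_simps mult_1_right) (intro mult_mono heat_kernel_nonneg, auto)
      qed (simp add: heat_kernel_nonneg)
      ultimately have "(LINT x|lborel. ?k * indicator (ball a 1) x) \<le> H t"
        unfolding H_def by (intro integral_mono) (auto intro!: integrable_mult_right integrable_real_indicator emeasure_lborel_ball_finite simp: less_top[symmetric])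
      moreover have "measure lborel (ball a 1) = v"
        by (simp add: v_def content_ball)
      ultimately show ?thesis by (simp add: h_def)
    qed
    have "c * (?r + 1) powr - (1 + DIM('a) / 2) * exp (- (5 / 4) * ?r) = g * h"
    proof -
      have "exp (- (?r + 1)) * exp (- (?r + 3) / 4) = exp (- 1) * exp (- (3 / 4)) * exp (- (5 / 4) * ?r)"
        by (simp flip: exp_add add: field_simps)
      moreover have "(?r + 1) powr - (1 + DIM('a) / 2) = (?r + 1) powr - (DIM('a) / 2) / (?r + 1)"
      proof -
        have "(?r + 1) powr - (1 + DIM('a) / 2) = (?r + 1) powr (- (DIM('a) / 2) - 1)"
          by (rule arg_cong) simp
        also have "\<dots> = (?r + 1) powr - (DIM('a) / 2) / (?r + 1)"
          using r by (subst powr_diff) simp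
        finally show ?thesis .
      qed
      moreover have "(4 * pi * (?r + 1)) powr - (DIM('a) / 2)
          = (4 * pi) powr - (DIM('a) / 2) * (?r + 1) powr - (DIM('a) / 2)"
        using r by (subst powr_mult) auto
      ultimately show ?thesis
        unfolding g_def h_def c_def by (simp add: mult_ac)
    qed
    also have "g * h = (LINT t|lborel. g * h * indicator {?r..?r + 1} t)"
      by simp
    also have "\<dots> \<le> (LINT t|lborel. gamma_density \<beta> t * H t)"
    proof (rule integral_mono)
      show "integrable lborel (\<lambda>t. gamma_density \<beta> t * H t)"
        using integrable_gamma_integral_heat_kernel[OF \<beta>, of ?\<phi> 1] by (simp add: H_def)
      show "g * h * indicator {?r..?r + 1} t \<le> gamma_density \<beta> t * H t" for t
      proof (cases "t \<in> {?r..?r + 1}")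
        case True
        then have t: "?r \<le> t" "t \<le> ?r + 1" by auto
        have "g * h \<le> gamma_density \<beta> t * H t"
          unfolding g_def using gamma_density_lower_bound[OF \<beta> r t] H[OF t] h0 gamma_density_nonneg[OF \<beta>]
          by (intro mult_mono)
        with True show ?thesis by simp
      qed (use gamma_density_nonneg[OF \<beta>] H0 in simp)
    qed (auto intro!: integrable_mult_right integrable_real_indicator)
    also have "\<dots> = (LINT x|lborel. subordinated_kernel \<beta> x * ?\<phi> x)"
      using integral_subordinated_kernel[OF \<beta>, of ?\<phi> 1] by (simp add: H_def)
    finally show "c * (norm a + 1) powr - (1 + DIM('a) / 2) * exp (- (5 / 4) * norm a)
      \<le> (LINT x|lborel. subordinated_kernel \<beta> x * exp (- (norm (x - a))\<^sup>2))" .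
  qed
qed

section \<open>The potential and the capacity\<close>

text \<open>\<open>ennreal\<close> cuts off the negative part, which only lowers the Bochner
  integral. Applied below to a kernel representative whose sign is not controlled pointwise.\<close>

lemma ennreal_integral_le_nn_integral:
  assumes "integrable M u"
  shows "ennreal (integral\<^sup>L M u) \<le> (\<integral>\<^sup>+ x. ennreal (u x) \<partial>M)"
proof -
  have int: "integrable M (\<lambda>x. max 0 (u x))"
    using assms by simp
  have "ennreal (integral\<^sup>L M u) \<le> ennreal (LINT x|M. max 0 (u x))"
    using assms int by (intro ennreal_leI integral_mono) auto
  also have "\<dots> = (\<integral>\<^sup>+ x. ennreal (max 0 (u x)) \<partial>M)"
    by (rule nn_integral_eq_integral[symmetric, OF int]) simp
  also have "\<dots> = (\<integral>\<^sup>+ x. ennreal (u x) \<partial>M)"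
    by (intro nn_integral_cong) (simp add: max_def ennreal_neg)
  finally show ?thesis .
qed

text \<open>Both kernels represent the same distribution, and the pairing with a Schwartz function
  depends on the distribution alone. This transfers information to the unknown
  representative.\<close>

lemma
  fixes a :: "real ^ 'n"
  assumes \<alpha>: "0 < \<alpha>"
  shows integrable_bessel_kernel_gaussian:
      "integrable lebesgue (\<lambda>x. bessel_kernel \<alpha> x * exp (- (norm (x - a))\<^sup>2))"
    and integral_bessel_kernel_gaussian:
      "(LINT x|lebesgue. bessel_kernel \<alpha> x * exp (- (norm (x - a))\<^sup>2))
        = (LINT x|lborel. subordinated_kernel (\<alpha> / 2) x * exp (- (norm (x - a))\<^sup>2))"
proof -
  define T where "T = inv_fourier_distr (regular_distr
      (\<lambda>\<xi>::real ^ 'n. (1 + 4 * pi\<^sup>2 * (norm \<xi>)\<^sup>2) powr (- \<alpha> / 2)))"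
  let ?\<phi> = "\<lambda>x. exp (- (norm (x - a))\<^sup>2)"
  let ?G = "subordinated_kernel (\<alpha> / 2) :: real ^ 'n \<Rightarrow> real"
  have pairing: "integrable lebesgue (\<lambda>x. g x * ?\<phi> x) \<and> T (\<lambda>x. complex_of_real (?\<phi> x)) = (LINT x|lebesgue. g x * ?\<phi> x)"
    if "distr_is_function T g" for g
  proof -
    have *: "(\<lambda>x. complex_of_real (g x) * complex_of_real (?\<phi> x)) = (\<lambda>x. complex_of_real (g x * ?\<phi> x))"
      by simp
    have "integrable lebesgue (\<lambda>x. complex_of_real (g x) * complex_of_real (?\<phi> x)) \<and>
        T (\<lambda>x. complex_of_real (?\<phi> x)) = regular_distr g (\<lambda>x. complex_of_real (?\<phi> x))"
      using that[unfolded distr_is_function_def] schwartz_gaussian[of a] by (elim conjE bspec)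
    then show ?thesis
      unfolding regular_distr_def * complex_of_real_integrable_eq integral_complex_of_real by blast
  qed
  have G: "distr_is_function T ?G"
    unfolding T_def by (rule distr_is_function_subordinated_kernel[OF \<alpha>])
  then have "distr_is_function T (Eps (distr_is_function T))"
    by (rule someI[of "distr_is_function T"])
  then have B: "distr_is_function T (bessel_kernel \<alpha>)"
    by (simp only: bessel_kernel_def T_def)
  show "integrable lebesgue (\<lambda>x. bessel_kernel \<alpha> x * ?\<phi> x)"
    using pairing[OF B] by blast
  have "(LINT x|lebesgue. bessel_kernel \<alpha> x * ?\<phi> x) = (LINT x|lebesgue. ?G x * ?\<phi> x)"
    using pairing[OF B] pairing[OF G] by (simp only: of_real_eq_iff)
  also have "\<dots> = (LINT x|lborel. ?G x * ?\<phi> x)"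
  proof (rule integral_completion)
    have [measurable]: "?G \<in> borel_measurable borel"
      using integrable_subordinated_kernel[of "\<alpha> / 2"] \<alpha> by auto
    show "(\<lambda>x. ?G x * ?\<phi> x) \<in> borel_measurable lborel" by measurable
  qed
  finally show "(LINT x|lebesgue. bessel_kernel \<alpha> x * ?\<phi> x) = (LINT x|lborel. ?G x * ?\<phi> x)" .
qed

lemma bessel_potential_exp:
  fixes x :: "real ^ 'n"
  assumes \<alpha>: "0 < \<alpha>" and \<epsilon>: "0 < \<epsilon>"
  shows "1 \<le> bessel_potential \<alpha> (\<lambda>y. \<epsilon> * exp (2 * norm y)) x"
proof -
  let ?s = "1 + CARD('n) / 2"
  obtain c where c: "c > 0" and lower: "\<And>a::real^'n. 1 \<le> norm a \<Longrightarrow>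
      c * (norm a + 1) powr - ?s * exp (- (5 / 4) * norm a)
      \<le> (LINT x|lborel. subordinated_kernel (\<alpha> / 2) x * exp (- (norm (x - a))\<^sup>2))"
    using subordinated_kernel_lower_bound[of "\<alpha> / 2", where 'a = "real ^ 'n"] \<alpha> by auto
  \<comment> \<open>Gathers the factors of the final bound that do not depend on the distance r of
    the test Gaussian from the origin.\<close>
  define k where "k = \<epsilon> * exp (- 2 * norm x - 1) * c"
  have "k > 0" using c \<epsilon> by (simp add: k_def)
  \<comment> \<open>The growth rate 2 of the function beats the decay rate 5/4 of the kernel and the
    power of r + 1, so a large r works even for small \<open>\<epsilon>\<close>.\<close>
  then have "filterlim (\<lambda>r. k * exp (2 * r) * ((r + 1) powr - ?s * exp (- (5 / 4) * r))) at_top at_top"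
    by real_asymp
  then have "eventually (\<lambda>r. 1 \<le> k * exp (2 * r) * ((r + 1) powr - ?s * exp (- (5 / 4) * r)) \<and> 1 \<le> r) at_top"
    unfolding filterlim_at_top using eventually_ge_at_top eventually_conj by blast
  then obtain r where r: "1 \<le> k * exp (2 * r) * ((r + 1) powr - ?s * exp (- (5 / 4) * r))" "1 \<le> r"
    by (auto dest!: eventually_happens)
  define a :: "real ^ 'n" where "a = r *\<^sub>R axis undefined 1"
  have a: "norm a = r" using r by (simp add: a_def)
  define K where "K = \<epsilon> * exp (- 2 * norm x + 2 * r - 1)"
  have K: "K > 0" using \<epsilon> by (simp add: K_def)
  let ?B = "bessel_kernel \<alpha> :: real ^ 'n \<Rightarrow> real"
  let ?\<phi> = "\<lambda>z. exp (- (norm (z - a))\<^sup>2)"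
  \<comment> \<open>Triangle inequalities give |x - z| \<ge> r - |z - a| - |x|, and 2 |z - a| \<le>
    1 + |z - a|^2 turns the exponential of the distance into the Gaussian; this 1 is the one
    subtracted in \<open>K\<close>.\<close>
  have dom: "K * ?\<phi> z \<le> \<epsilon> * exp (2 * norm (x - z))" for z
  proof -
    let ?s = "norm (z - a)"
    have "norm a \<le> norm z + ?s" "norm z \<le> norm x + norm (x - z)"
      using norm_triangle_ineq4[of z "z - a"] norm_triangle_ineq4[of x "x - z"] by simp_all
    moreover have "2 * ?s \<le> 1 + ?s\<^sup>2"
      using zero_le_power2[of "?s - 1"] by (simp add: power2_eq_square algebra_simps)
    ultimately have "- 2 * norm x + 2 * r - 1 - ?s\<^sup>2 \<le> 2 * norm (x - z)"
      using a by linarith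
    then have "exp (- 2 * norm x + 2 * r - 1 - ?s\<^sup>2) \<le> exp (2 * norm (x - z))" by simp
    moreover have "K * ?\<phi> z = \<epsilon> * exp (- 2 * norm x + 2 * r - 1 - ?s\<^sup>2)"
      by (simp add: K_def exp_diff exp_minus divide_inverse)
    ultimately show ?thesis using \<epsilon> by simp
  qed
  have int: "integrable lebesgue (\<lambda>z. ?B z * ?\<phi> z)"
    by (rule integrable_bessel_kernel_gaussian[OF \<alpha>])
  \<comment> \<open>The integrable product with the Gaussian is measurable; multiplying by the
    reciprocal Gaussian recovers the kernel itself.\<close>
  have [measurable]: "?B \<in> borel_measurable lebesgue"
  proof -
    have "(\<lambda>z. exp ((norm (z - a))\<^sup>2)) \<in> borel_measurable lebesgue"
      by (intro measurable_completion) simp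
    moreover have "(\<lambda>z. ?B z * ?\<phi> z) \<in> borel_measurable lebesgue"
      using int by (rule borel_measurable_integrable)
    ultimately have "(\<lambda>z. (?B z * ?\<phi> z) * exp ((norm (z - a))\<^sup>2)) \<in> borel_measurable lebesgue"
      by (rule borel_measurable_times[rotated])
    then show ?thesis by (simp add: mult.assoc flip: exp_add)
  qed
  have [measurable]: "(\<lambda>z. \<epsilon> * exp (2 * norm (x - z))) \<in> borel_measurable lebesgue"
    by (intro measurable_completion) simp
  have "1 \<le> K * (c * (r + 1) powr - ?s * exp (- (5 / 4) * r))"
  proof -
    have "exp (- 2 * norm x + 2 * r - 1) = exp (- 2 * norm x - 1) * exp (2 * r)"
      by (simp flip: exp_add)
    then have "K * (c * (r + 1) powr - ?s * exp (- (5 / 4) * r))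
        = k * exp (2 * r) * ((r + 1) powr - ?s * exp (- (5 / 4) * r))"
      by (simp only: K_def k_def mult_ac)
    then show ?thesis using r(1) by (simp only:)
  qed
  also have "\<dots> \<le> K * (LINT z|lborel. subordinated_kernel (\<alpha> / 2) z * ?\<phi> z)"
    using lower[of a] a r K by (intro mult_left_mono) auto
  also have "\<dots> = (LINT z|lebesgue. K * (?B z * ?\<phi> z))"
    by (simp add: integral_bessel_kernel_gaussian[OF \<alpha>])
  finally have "1 \<le> ennreal (LINT z|lebesgue. K * (?B z * ?\<phi> z))"
    using ennreal_leI by fastforce
  also have "\<dots> \<le> (\<integral>\<^sup>+ z. ennreal (K * (?B z * ?\<phi> z)) \<partial>lebesgue)"
    using int by (intro ennreal_integral_le_nn_integral integrable_mult_right)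
  also have "\<dots> \<le> (\<integral>\<^sup>+ z. ennreal (?B z * (\<epsilon> * exp (2 * norm (x - z)))) \<partial>lebesgue)"
  proof (intro nn_integral_mono)
    fix z
    show "ennreal (K * (?B z * ?\<phi> z)) \<le> ennreal (?B z * (\<epsilon> * exp (2 * norm (x - z))))"
    \<comment> \<open>Where the representative is negative, the left side is truncated to 0, so the
      domination \<open>dom\<close> is needed only for nonnegative values.\<close>
    proof (cases "?B z \<ge> 0")
      case True
      then show ?thesis
        using mult_left_mono[OF dom True, of z] by (intro ennreal_leI) (simp add: mult_ac)
    next
      case False
      then have "K * (?B z * ?\<phi> z) \<le> 0"
        using K by (simp add: mult_le_0_iff)
      then show ?thesis by (simp add: ennreal_neg)
    qed
  qed
  also have "\<dots> = bessel_potential \<alpha> (\<lambda>y. \<epsilon> * exp (2 * norm y)) x"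
    unfolding bessel_potential_def
    by (subst nn_integral_lebesgue_reflect[symmetric, where x = x]) auto
  finally show ?thesis .
qed

lemma integrable_exp_minus_norm:
  fixes p :: real
  assumes p: "1 < p"
  shows "integrable lborel (\<lambda>x::real ^ 'n. exp (- p * norm x))"
proof (rule Bochner_Integration.integrable_bound)
  let ?C = "fact (2 * CARD('n)) * exp 1 :: real"
  show "integrable lborel (\<lambda>x::real ^ 'n. ?C * decay x)"
    by (intro integrable_mult_right integrable_decay)
  have "exp (- p * norm x) \<le> ?C * decay x" for x :: "real ^ 'n"
  proof -
    have "(1 + (norm x)\<^sup>2) ^ CARD('n) \<le> ((1 + norm x)\<^sup>2) ^ CARD('n)"
      by (intro power_mono) (auto simp: power2_eq_square algebra_simps)
    also have "\<dots> = (1 + norm x) ^ (2 * CARD('n))"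
      by (simp add: power_mult)
    also have "\<dots> \<le> fact (2 * CARD('n)) * exp (1 + norm x)"
      by (rule power_le_fact_mult_exp) simp
    also have "\<dots> = ?C * exp (norm x)"
      by (simp add: exp_add)
    also have "\<dots> \<le> ?C * exp (p * norm x)"
      using p mult_right_mono[of 1 p "norm x"] by simp
    finally show ?thesis
      by (simp add: decay_def exp_minus field_simps add_pos_nonneg)
  qed
  then show "AE x in lborel. norm (exp (- p * norm x)) \<le> norm (?C * decay (x::real ^ 'n))"
    by (intro AE_I2) (auto intro: order.trans[OF _ abs_ge_self])
qed simp

lemma bessel_capacity_exp_weight:
  fixes \<alpha> p :: real
  assumes \<alpha>: "0 < \<alpha>" and p: "1 < p"
  shows "bessel_capacity \<alpha> p (\<lambda>x::real ^ 'n. exp (- 3 * p * norm x)) UNIV = 0"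
proof -
  define k where "k = (LINT x::real ^ 'n|lborel. exp (- p * norm x))"
  have k: "k \<ge> 0" by (simp add: k_def)
  have "bessel_capacity \<alpha> p (\<lambda>x::real ^ 'n. exp (- 3 * p * norm x)) UNIV \<le> 0 + ennreal e" if "e > 0" for e
  proof -
    \<comment> \<open>Chosen so that \<epsilon>^p k = e k / (k + 1) \<le> e; the added 1 keeps the
      quotient meaningful for any \<open>k \<ge> 0\<close>.\<close>
    define \<epsilon> where "\<epsilon> = (e / (k + 1)) powr (1 / p)"
    have \<epsilon>: "\<epsilon> > 0" "\<epsilon> powr p = e / (k + 1)"
      using that k p by (auto simp: \<epsilon>_def powr_powr)
    let ?f = "\<lambda>x::real ^ 'n. \<epsilon> * exp (2 * norm x)"
    \<comment> \<open>The exponents combine to 2 p - 3 p = - p, which leaves an integrable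
      exponential.\<close>
    have "?f x powr p * exp (- 3 * p * norm x) = e / (k + 1) * exp (- p * norm x)" for x
      using \<epsilon> by (simp add: powr_mult exp_powr_real algebra_simps flip: exp_add)
    then have "(\<integral>\<^sup>+ x. ennreal (?f x powr p * exp (- 3 * p * norm x)) \<partial>lebesgue)
        = (\<integral>\<^sup>+ (x::real ^ 'n). ennreal (e / (k + 1) * exp (- p * norm x)) \<partial>lborel)"
      by (simp only: nn_integral_completion)
    also have "\<dots> = ennreal (LINT x::real ^ 'n|lborel. e / (k + 1) * exp (- p * norm x))"
      using that k by (intro nn_integral_eq_integral integrable_mult_right integrable_exp_minus_norm p) auto
    also have "\<dots> = ennreal (e / (k + 1) * k)"
      by (simp add: k_def)
    finally have eq: "(\<integral>\<^sup>+ x. ennreal (?f x powr p * exp (- 3 * p * norm x)) \<partial>lebesgue) = ennreal (e / (k + 1) * k)" .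
    have "?f \<in> borel_measurable lebesgue"
      by (intro measurable_completion) simp
    moreover have "\<forall>x\<in>UNIV. 1 \<le> bessel_potential \<alpha> ?f x"
      using bessel_potential_exp[OF \<alpha> \<epsilon>(1)] by blast
    ultimately have "bessel_capacity \<alpha> p (\<lambda>x::real ^ 'n. exp (- 3 * p * norm x)) UNIV \<le> ennreal (e / (k + 1) * k)"
      unfolding bessel_capacity_def
    proof (intro Inf_lower CollectI exI[of _ ?f] conjI allI)
      show "0 \<le> ?f x" for x using \<epsilon>(1) by simp
    qed (simp_all only: eq infinity_ennreal_def ennreal_less_top)
    also have "\<dots> \<le> ennreal e"
      using that k by (intro ennreal_leI) (simp add: field_simps)
    finally show ?thesis by simp
  qed
  then have "bessel_capacity \<alpha> p (\<lambda>x::real ^ 'n. exp (- 3 * p * norm x)) UNIV \<le> 0"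
    by (rule ennreal_le_epsilon)
  then show ?thesis by simp
qed

section \<open>The local A_infinity condition\<close>

lemma average_le:
  assumes "Q \<in> lmeasurable" and "0 < measure lebesgue Q" and "set_integrable lebesgue Q g"
    and "\<And>x. x \<in> Q \<Longrightarrow> g x \<le> b"
  shows "average Q g \<le> b"
proof -
  have "(LINT x:Q|lebesgue. g x) \<le> (LINT x:Q|lebesgue. b)"
    using assms by (intro set_integral_mono) (auto simp: set_integrable_def fmeasurable_def)
  also have "\<dots> = b * measure lebesgue Q"
    using assms by (simp add: set_lebesgue_integral_def fmeasurableD)
  finally show ?thesis
    using assms by (simp add: average_def pos_divide_le_eq)
qed

text \<open>On a cube of side at most 1 the norm deviates from its value at the corner a by at most
  \<open>CARD('n)\<close>. Both averages are therefore known up to constants, and the terms with |a|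
  cancel in the product, leaving a bound uniform over all cubes.\<close>

lemma exp_weight_A_infty_loc:
  fixes c :: real
  assumes c: "0 \<le> c"
  shows "(\<lambda>x::real ^ 'n. exp (- c * norm x)) \<in> A_infty_loc"
proof -
  let ?\<omega> = "\<lambda>x::real ^ 'n. exp (- c * norm x)"
  let ?n = "real CARD('n)"
  have cont: "set_integrable lebesgue K g" if "compact K" "continuous_on UNIV g" for K and g :: "real ^ 'n \<Rightarrow> real"
  proof -
    have int: "integrable lborel (\<lambda>x. indicator K x *\<^sub>R g x)"
      using that by (intro borel_integrable_compact) (auto intro: continuous_on_subset)
    then show ?thesis
      unfolding set_integrable_def using integrable_completion[of _ lborel] borel_measurable_integrable by blast
  qed
  have "weight ?\<omega>"
    unfolding weight_def locally_integrable_def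
    by (auto intro!: cont continuous_intros)
  moreover have ln: "set_integrable lebesgue (cube a l) (\<lambda>x. ln (1 / ?\<omega> x))" for a l
    unfolding cube_def by (intro cont compact_cbox continuous_intros) auto
  moreover have "average (cube a l) ?\<omega> * exp (average (cube a l) (\<lambda>x. ln (1 / ?\<omega> x))) \<le> exp (2 * c * ?n)"
    if l: "0 < l" "l \<le> 1" for a l
  proof -
    have near: "\<bar>norm x - norm a\<bar> \<le> ?n" if "x \<in> cube a l" for x
    proof -
      have "\<bar>norm x - norm a\<bar> \<le> norm (x - a)" by (rule norm_triangle_ineq3)
      also have "\<dots> \<le> (\<Sum>i\<in>UNIV. \<bar>(x - a) $ i\<bar>)" by (rule norm_le_l1_cart)
      also have "\<dots> \<le> (\<Sum>i\<in>(UNIV::'n set). 1)"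
      proof (rule sum_mono)
        fix i
        have "a $ i \<le> x $ i" "x $ i \<le> a $ i + l"
          using that by (auto simp: cube_def mem_box_cart)
        then show "\<bar>(x - a) $ i\<bar> \<le> 1" using l by simp
      qed
      finally show ?thesis by simp
    qed
    have Q: "cube a l \<in> lmeasurable" by (simp add: cube_def)
    have pos: "0 < measure lebesgue (cube a l)"
    proof -
      have "0 < measure lborel (cbox a (\<chi> i. a $ i + l))"
        using l by (auto simp: content_pos_lt_eq Basis_vec_def inner_axis)
      then show ?thesis by (simp add: cube_def measure_completion)
    qed
    have "average (cube a l) ?\<omega> \<le> exp (c * (?n - norm a))"
    proof (rule average_le[OF Q pos])
      show "set_integrable lebesgue (cube a l) ?\<omega>"
        unfolding cube_def by (intro cont compact_cbox continuous_intros)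
      fix x assume "x \<in> cube a l"
      then have "- norm x \<le> ?n - norm a" using near[of x] by linarith
      then show "?\<omega> x \<le> exp (c * (?n - norm a))"
        using mult_left_mono[of "- norm x" "?n - norm a" c] c by simp
    qed
    moreover have "average (cube a l) (\<lambda>x. ln (1 / ?\<omega> x)) \<le> c * (norm a + ?n)"
    proof (rule average_le[OF Q pos ln])
      fix x assume "x \<in> cube a l"
      then have "norm x \<le> norm a + ?n" using near[of x] by linarith
      then show "ln (1 / ?\<omega> x) \<le> c * (norm a + ?n)"
        using mult_left_mono[of "norm x" "norm a + ?n" c] c by (simp add: ln_div)
    qed
    ultimately have "average (cube a l) ?\<omega> * exp (average (cube a l) (\<lambda>x. ln (1 / ?\<omega> x)))
        \<le> exp (c * (?n - norm a)) * exp (c * (norm a + ?n))"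
      by (intro mult_mono) auto
    also have "\<dots> = exp (2 * c * ?n)"
      by (simp flip: exp_add add: algebra_simps)
    finally show ?thesis .
  qed
  then have "bdd_above {average (cube a l) ?\<omega> * exp (average (cube a l) (\<lambda>x. ln (1 / ?\<omega> x))) | a l.
       0 < l \<and> l \<le> 1}"
    by (intro bdd_aboveI[of _ "exp (2 * c * ?n)"]) auto
  ultimately show ?thesis
    unfolding A_infty_loc_def by blast
qed

theorem theorem3p5p5:
  fixes \<alpha> p :: real and \<omega> :: "real ^ 'n \<Rightarrow> real"
  assumes "0 < \<alpha>" and "\<alpha> < real CARD('n)" and "1 < p"
    and "\<omega> = (\<lambda>x. exp (- 3 * p * norm x))"
  shows "\<omega> \<in> A_infty_loc \<and> bessel_capacity \<alpha> p \<omega> UNIV = 0"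
  using exp_weight_A_infty_loc[of "3 * p", where 'n = 'n] bessel_capacity_exp_weight[OF assms(1,3), where 'n = 'n]
    assms(3,4) by simp

end
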